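(* Let $(X,G,\Phi)$ be a dynamical system, where $X$ is a compact metric space. Let property $P$ be one of the following properties: transitivity, total transitivity, weak mixing, and mixing. Then $\Phi$ has property $P$ if and only if $(X,G,\Phi)$ is a factor of the inverse limit of an ML inverse system of subshifts (over $G$) with property $P$.
   Context: $G$ is a countable discrete group with identity $e_G$. A dynamical system $(X,G,\Phi)$ consists of a compact Hausdorff space $X$ and $\Phi:G\times X\to X$ such that each $\Phi_g:=\Phi(g,\cdot)$ is a homeomorphism, $\Phi_{e_G}=\mathrm{id}_X$ and $\Phi_{gg'}=\Phi_g\circ\Phi_{g'}$. Dynamical properties. For nonempty $U,V\subset X$ let $N(U,V)=\{g\in G\setminus\{e_G\}:U\cap\Phi_{g^{-1}}(V)\neq\emptyset\}$. The system $(X,G,\Phi)$ (or $\Phi$) is: - transitive if $N(U,V)$ is infinite for all nonempty open $U,V\subset X$; - totally transitive if for any countable subset $K\subset G$ and any two nonempty open $U,V\subset X$, $N(U,V)\cap G'\neq\emptyset$, where $G'$ is the group generated by $K$; - weakly mixing if $(X\times X,G,\Phi\times\Phi)$ is transitive, where $(\Phi\times\Phi)_g=\Phi_g\times\Phi_g$; - mixing if $G\setminus N(U,V)$ is finite for all nonempty open $U,V\subset X$. Subshifts. For a finite set $\Sigma$, $G$ acts on $\Sigma^G$ (product topology, $\Sigma$ discrete) by $\sigma_g(x)(h)=x(hg)$. A subshift is a closed $G$-invariant subset of some $\Sigma^G$, regarded as a dynamical system under $\sigma$. Inverse limits. For a directed set $(\Lambda,\le)$, an inverse system $(\phi^\eta_\lambda,(X_\lambda,G,\Phi^\lambda))$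 of dynamical systems consists of dynamical systems $(X_\lambda,G,\Phi^\lambda)$, $\lambda\in\Lambda$, and continuous (not necessarily surjective) maps $\phi^\eta_\lambda:X_\eta\to X_\lambda$ for $\lambda\le\eta$ with $\phi^\lambda_\lambda=\mathrm{id}$, $\phi^\gamma_\lambda=\phi^\eta_\lambda\circ\phi^\gamma_\eta$ for $\lambda\le\eta\le\gamma$, and $\Phi^\lambda_g\circ\phi^\eta_\lambda=\phi^\eta_\lambda\circ\Phi^\eta_g$ for all $g\in G$. Its inverse limit is the space of all $(x_\lambda)\in\prod_\lambda X_\lambda$ with $x_\lambda=\phi^\eta_\lambda(x_\eta)$ for all $\lambda\le\eta$, with the subspace topology and the coordinatewise $G$-action. It is an ML inverse system (satisfies the Mittag-Leffler condition) if for every $\lambda$ there is $\eta\ge\lambda$ such that $\phi^\gamma_\lambda(X_\gamma)=\phi^\eta_\lambda(X_\eta)$ for all $\gamma\ge\eta$. $(Y,G,\Phi^Y)$ is a factor of $(Z,G,\Phi^Z)$ if there is a continuous surjection $\phi:Z\to Y$ with $\Phi^Y_g\circ\phi=\phi\circ\Phi^Z_g$ for all $g\in G$.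
   Formalization: In the definition of total transitivity, the sets K contained in {e_G} are excluded: they generate the trivial group, and since N(U,V) omits e_G, no nonempty system could otherwise be totally transitive. *)

theory Defs
  imports
    "HOL-Analysis.Analysis"
    "HOL-Algebra.Generated_Groups"
    "HOL-Library.Infinite_Typeclass"
begin

section \<open>Dynamical systems\<close>

definition dynamical_system ::
    "'x topology \<Rightarrow> ('g, 'b) monoid_scheme \<Rightarrow> ('g \<Rightarrow> 'x \<Rightarrow> 'x) \<Rightarrow> bool" where
  "dynamical_system X G \<Phi> \<longleftrightarrow>
     compact_space X \<and> Hausdorff_space X \<and>
     (\<forall>g\<in>carrier G. homeomorphic_map X X (\<Phi> g)) \<and>
     (\<forall>x\<in>topspace X. \<Phi> \<one>\<^bsub>G\<^esub> x = x) \<and>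
     (\<forall>g\<in>carrier G. \<forall>h\<in>carrier G. \<forall>x\<in>topspace X. \<Phi> (g \<otimes>\<^bsub>G\<^esub> h) x = \<Phi> g (\<Phi> h x))"

definition return_times ::
    "('g, 'b) monoid_scheme \<Rightarrow> ('g \<Rightarrow> 'x \<Rightarrow> 'x) \<Rightarrow> 'x set \<Rightarrow> 'x set \<Rightarrow> 'g set" where
  "return_times G \<Phi> U V = {g \<in> carrier G - {\<one>\<^bsub>G\<^esub>}. U \<inter> \<Phi> (inv\<^bsub>G\<^esub> g) ` V \<noteq> {}}"

definition transitive_system ::
    "'x topology \<Rightarrow> ('g, 'b) monoid_scheme \<Rightarrow> ('g \<Rightarrow> 'x \<Rightarrow> 'x) \<Rightarrow> bool" where
  "transitive_system X G \<Phi> \<longleftrightarrow>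
     (\<forall>U V. openin X U \<and> openin X V \<and> U \<noteq> {} \<and> V \<noteq> {} \<longrightarrow> infinite (return_times G \<Phi> U V))"

text \<open>
  The return times never contain the identity, so the condition fails for every nonempty space
  when \<open>K\<close> generates the trivial group. These \<open>K\<close> (the empty set and the singleton of the
  identity), and only these, are therefore excluded.
\<close>

definition totally_transitive_system ::
    "'x topology \<Rightarrow> ('g, 'b) monoid_scheme \<Rightarrow> ('g \<Rightarrow> 'x \<Rightarrow> 'x) \<Rightarrow> bool" where
  "totally_transitive_system X G \<Phi> \<longleftrightarrow>
     (\<forall>K. K \<subseteq> carrier G \<and> countable K \<and> \<not> K \<subseteq> {\<one>\<^bsub>G\<^esub>} \<longrightarrow>
        (\<forall>U V. openin X U \<and> openin X V \<and> U \<noteq> {} \<and> V \<noteq> {} \<longrightarrow>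
           return_times G \<Phi> U V \<inter> generate G K \<noteq> {}))"

definition weakly_mixing_system ::
    "'x topology \<Rightarrow> ('g, 'b) monoid_scheme \<Rightarrow> ('g \<Rightarrow> 'x \<Rightarrow> 'x) \<Rightarrow> bool" where
  "weakly_mixing_system X G \<Phi> \<longleftrightarrow>
     transitive_system (prod_topology X X) G (\<lambda>g. map_prod (\<Phi> g) (\<Phi> g))"

definition mixing_system ::
    "'x topology \<Rightarrow> ('g, 'b) monoid_scheme \<Rightarrow> ('g \<Rightarrow> 'x \<Rightarrow> 'x) \<Rightarrow> bool" where
  "mixing_system X G \<Phi> \<longleftrightarrow>
     (\<forall>U V. openin X U \<and> openin X V \<and> U \<noteq> {} \<and> V \<noteq> {} \<longrightarrow>
        finite (carrier G - return_times G \<Phi> U V))"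

text \<open>
  Names for the properties: a variable ranging over predicates could not be applied
  to systems on spaces of different types.
\<close>

datatype dynamical_property = Transitivity | Total_Transitivity | Weak_Mixing | Mixing

primrec has_property ::
    "dynamical_property \<Rightarrow> 'x topology \<Rightarrow> ('g, 'b) monoid_scheme \<Rightarrow> ('g \<Rightarrow> 'x \<Rightarrow> 'x) \<Rightarrow> bool" where
  "has_property Transitivity = transitive_system"
| "has_property Total_Transitivity = totally_transitive_system"
| "has_property Weak_Mixing = weakly_mixing_system"
| "has_property Mixing = mixing_system"

definition is_factor ::
    "('g, 'b) monoid_scheme \<Rightarrow> 'y topology \<Rightarrow> ('g \<Rightarrow> 'y \<Rightarrow> 'y) \<Rightarrow>
     'z topology \<Rightarrow> ('g \<Rightarrow> 'z \<Rightarrow> 'z) \<Rightarrow> bool" where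
  "is_factor G Y \<Phi>Y Z \<Phi>Z \<longleftrightarrow>
     (\<exists>f. continuous_map Z Y f \<and> f ` topspace Z = topspace Y \<and>
          (\<forall>g\<in>carrier G. \<forall>z\<in>topspace Z. \<Phi>Y g (f z) = f (\<Phi>Z g z)))"

section \<open>Subshifts\<close>

definition full_shift :: "('g, 'b) monoid_scheme \<Rightarrow> 'a set \<Rightarrow> ('g \<Rightarrow> 'a) topology" where
  "full_shift G A = product_topology (\<lambda>_. discrete_topology A) (carrier G)"

definition shift :: "('g, 'b) monoid_scheme \<Rightarrow> 'g \<Rightarrow> ('g \<Rightarrow> 'a) \<Rightarrow> ('g \<Rightarrow> 'a)" where
  "shift G g x = (\<lambda>h\<in>carrier G. x (h \<otimes>\<^bsub>G\<^esub> g))"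

definition subshift :: "('g, 'b) monoid_scheme \<Rightarrow> 'a set \<Rightarrow> ('g \<Rightarrow> 'a) set \<Rightarrow> bool" where
  "subshift G A S \<longleftrightarrow>
     finite A \<and> closedin (full_shift G A) S \<and> (\<forall>g\<in>carrier G. shift G g ` S \<subseteq> S)"

definition subshift_space ::
    "('g, 'b) monoid_scheme \<Rightarrow> 'a set \<Rightarrow> ('g \<Rightarrow> 'a) set \<Rightarrow> ('g \<Rightarrow> 'a) topology" where
  "subshift_space G A S = subtopology (full_shift G A) S"

section \<open>Inverse systems\<close>

definition directed_set :: "'l set \<Rightarrow> ('l \<Rightarrow> 'l \<Rightarrow> bool) \<Rightarrow> bool" where
  "directed_set L leq \<longleftrightarrow>
     L \<noteq> {} \<and> (\<forall>l\<in>L. leq l l) \<and>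
     (\<forall>l\<in>L. \<forall>m\<in>L. \<forall>n\<in>L. leq l m \<longrightarrow> leq m n \<longrightarrow> leq l n) \<and>
     (\<forall>l\<in>L. \<forall>m\<in>L. \<exists>n\<in>L. leq l n \<and> leq m n)"

text \<open>For \<open>leq l m\<close>, the bonding map \<open>\<phi> l m\<close> goes from \<open>X m\<close> to \<open>X l\<close>.\<close>

definition inverse_system ::
    "('g, 'b) monoid_scheme \<Rightarrow> 'l set \<Rightarrow> ('l \<Rightarrow> 'l \<Rightarrow> bool) \<Rightarrow> ('l \<Rightarrow> 'x topology) \<Rightarrow>
     ('l \<Rightarrow> 'g \<Rightarrow> 'x \<Rightarrow> 'x) \<Rightarrow> ('l \<Rightarrow> 'l \<Rightarrow> 'x \<Rightarrow> 'x) \<Rightarrow> bool" where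
  "inverse_system G L leq X \<Phi> \<phi> \<longleftrightarrow>
     directed_set L leq \<and>
     (\<forall>l\<in>L. dynamical_system (X l) G (\<Phi> l)) \<and>
     (\<forall>l\<in>L. \<forall>m\<in>L. leq l m \<longrightarrow> continuous_map (X m) (X l) (\<phi> l m)) \<and>
     (\<forall>l\<in>L. \<forall>x\<in>topspace (X l). \<phi> l l x = x) \<and>
     (\<forall>l\<in>L. \<forall>m\<in>L. \<forall>n\<in>L. leq l m \<longrightarrow> leq m n \<longrightarrow>
        (\<forall>x\<in>topspace (X n). \<phi> l n x = \<phi> l m (\<phi> m n x))) \<and>
     (\<forall>l\<in>L. \<forall>m\<in>L. leq l m \<longrightarrow>
        (\<forall>g\<in>carrier G. \<forall>x\<in>topspace (X m). \<Phi> l g (\<phi> l m x) = \<phi> l m (\<Phi> m g x)))"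

definition Mittag_Leffler ::
    "'l set \<Rightarrow> ('l \<Rightarrow> 'l \<Rightarrow> bool) \<Rightarrow> ('l \<Rightarrow> 'x topology) \<Rightarrow> ('l \<Rightarrow> 'l \<Rightarrow> 'x \<Rightarrow> 'x) \<Rightarrow> bool" where
  "Mittag_Leffler L leq X \<phi> \<longleftrightarrow>
     (\<forall>l\<in>L. \<exists>m\<in>L. leq l m \<and>
        (\<forall>n\<in>L. leq m n \<longrightarrow> \<phi> l n ` topspace (X n) = \<phi> l m ` topspace (X m)))"

definition Mittag_Leffler_system ::
    "('g, 'b) monoid_scheme \<Rightarrow> 'l set \<Rightarrow> ('l \<Rightarrow> 'l \<Rightarrow> bool) \<Rightarrow> ('l \<Rightarrow> 'x topology) \<Rightarrow>
     ('l \<Rightarrow> 'g \<Rightarrow> 'x \<Rightarrow> 'x) \<Rightarrow> ('l \<Rightarrow> 'l \<Rightarrow> 'x \<Rightarrow> 'x) \<Rightarrow> bool" where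
  "Mittag_Leffler_system G L leq X \<Phi> \<phi> \<longleftrightarrow>
     inverse_system G L leq X \<Phi> \<phi> \<and> Mittag_Leffler L leq X \<phi>"

definition inverse_limit ::
    "'l set \<Rightarrow> ('l \<Rightarrow> 'l \<Rightarrow> bool) \<Rightarrow> ('l \<Rightarrow> 'x topology) \<Rightarrow> ('l \<Rightarrow> 'l \<Rightarrow> 'x \<Rightarrow> 'x) \<Rightarrow>
     ('l \<Rightarrow> 'x) topology" where
  "inverse_limit L leq X \<phi> =
     subtopology (product_topology X L)
       {x \<in> \<Pi>\<^sub>E l\<in>L. topspace (X l). \<forall>l\<in>L. \<forall>m\<in>L. leq l m \<longrightarrow> x l = \<phi> l m (x m)}"

definition coordinatewise_action ::
    "'l set \<Rightarrow> ('l \<Rightarrow> 'g \<Rightarrow> 'x \<Rightarrow> 'x) \<Rightarrow> 'g \<Rightarrow> ('l \<Rightarrow> 'x) \<Rightarrow> ('l \<Rightarrow> 'x)" where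
  "coordinatewise_action L \<Phi> g x = (\<lambda>l\<in>L. \<Phi> l g (x l))"

text \<open>
  HOL cannot quantify over the types of the index set and of the alphabets, so these are
  type parameters. They are required to be infinite so that there is room for some index set
  that works; the types themselves are arbitrary. Finite alphabets embed in every infinite type.
\<close>

definition is_factor_of_ML_limit_of_subshifts ::
    "'l::infinite itself \<Rightarrow> 'a::infinite itself \<Rightarrow> dynamical_property \<Rightarrow>
     'x topology \<Rightarrow> ('g, 'b) monoid_scheme \<Rightarrow> ('g \<Rightarrow> 'x \<Rightarrow> 'x) \<Rightarrow> bool" where
  "is_factor_of_ML_limit_of_subshifts _ _ P X G \<Phi> \<longleftrightarrow>
     (\<exists>(L :: 'l set) leq (A :: 'l \<Rightarrow> 'a set) S \<phi>.
        (\<forall>l\<in>L. subshift G (A l) (S l) \<and>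
                has_property P (subshift_space G (A l) (S l)) G (shift G)) \<and>
        Mittag_Leffler_system G L leq (\<lambda>l. subshift_space G (A l) (S l)) (\<lambda>_. shift G) \<phi> \<and>
        is_factor G X \<Phi>
          (inverse_limit L leq (\<lambda>l. subshift_space G (A l) (S l)) \<phi>)
          (coordinatewise_action L (\<lambda>_. shift G)))"

end

theory Submission
  imports Defs
begin

text \<open>
  All four properties only depend on the sets of return times between open sets, and they pass
  to any system whose return time sets contain those of systems with the property. This gives the
  preservation under factors and, since by compactness every point of a stable image lifts to the
  limit, under limits of Mittag-Leffler systems.

  Conversely, let \<open>B\<^sub>0, B\<^sub>1, \<dots>\<close> be open sets such that for all \<open>x \<noteq> y\<close> some \<open>B\<^sub>i\<close> contains \<open>x\<close>
  while its closure omits \<open>y\<close>. By Baire, the points whose orbits avoid all frontiers of the \<open>B\<^sub>i\<close>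
  are dense. Recording for each \<open>g\<close> which of \<open>B\<^sub>0, \<dots>, B\<^sub>n\<^sub>-\<^sub>1\<close> contain \<open>\<Phi>\<^sub>g x\<close> is
  continuous on this set, so the closures \<open>S\<^sub>n\<close> of the images are subshifts that inherit the
  property from \<open>X\<close>. Forgetting \<open>B\<^sub>n\<close> maps \<open>S\<^sub>n\<^sub>+\<^sub>1\<close> onto \<open>S\<^sub>n\<close>, and a point of the limit
  determines a point of \<open>X\<close> because the \<open>B\<^sub>i\<close> separate points.
\<close>

section \<open>Return times and transfer of the dynamical properties\<close>

lemma dynamical_system_closed:
  assumes "dynamical_system X G \<Phi>" "g \<in> carrier G"
  shows "continuous_map X X (\<Phi> g)" "x \<in> topspace X \<Longrightarrow> \<Phi> g x \<in> topspace X"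
proof -
  have "homeomorphic_map X X (\<Phi> g)"
    using assms by (simp add: dynamical_system_def)
  then show "continuous_map X X (\<Phi> g)"
    by (rule homeomorphic_imp_continuous_map)
  then show "x \<in> topspace X \<Longrightarrow> \<Phi> g x \<in> topspace X"
    by (auto simp: continuous_map_def)
qed

lemma (in group) dynamical_system_inv:
  assumes "dynamical_system X G \<Phi>" "g \<in> carrier G" "x \<in> topspace X"
  shows "\<Phi> g (\<Phi> (inv g) x) = x" "\<Phi> (inv g) (\<Phi> g x) = x"
proof -
  have mult: "\<Phi> (h \<otimes> k) x = \<Phi> h (\<Phi> k x)" if "h \<in> carrier G" "k \<in> carrier G" for h k
    using assms(1,3) that by (simp add: dynamical_system_def)
  have one: "\<Phi> \<one> x = x"
    using assms(1,3) by (simp add: dynamical_system_def)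
  show "\<Phi> g (\<Phi> (inv g) x) = x" "\<Phi> (inv g) (\<Phi> g x) = x"
    using mult[of g "inv g"] mult[of "inv g" g] one assms(2) by simp_all
qed

text \<open>The continuous map \<open>\<Phi> (inv g)\<close> inverts \<open>\<Phi> g\<close>, so
  continuity of all the maps already makes each of them a homeomorphism.\<close>

lemma (in group) dynamical_systemI:
  assumes "compact_space X" "Hausdorff_space X"
    and cont: "\<And>g. g \<in> carrier G \<Longrightarrow> continuous_map X X (\<Phi> g)"
    and one: "\<And>x. x \<in> topspace X \<Longrightarrow> \<Phi> \<one> x = x"
    and mult: "\<And>g h x. g \<in> carrier G \<Longrightarrow> h \<in> carrier G \<Longrightarrow> x \<in> topspace X
                 \<Longrightarrow> \<Phi> (g \<otimes> h) x = \<Phi> g (\<Phi> h x)"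
  shows "dynamical_system X G \<Phi>"
proof -
  have "homeomorphic_map X X (\<Phi> g)" if "g \<in> carrier G" for g
  proof -
    have "\<Phi> g (\<Phi> (inv g) x) = x" "\<Phi> (inv g) (\<Phi> g x) = x" if "x \<in> topspace X" for x
      using mult[of g "inv g" x] mult[of "inv g" g x] one[OF that] \<open>g \<in> carrier G\<close> that by simp_all
    then have "homeomorphic_maps X X (\<Phi> g) (\<Phi> (inv g))"
      using that cont by (auto simp: homeomorphic_maps_def)
    then show ?thesis
      by (auto simp: homeomorphic_map_maps)
  qed
  then show ?thesis
    using assms by (simp add: dynamical_system_def)
qed

text \<open>The maps of \<open>g\<close> and \<open>inv g\<close> are mutually inverse, so the image
  of \<open>V\<close> under one is its preimage under the other. From here on return times are
  handled as forward visits.\<close>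

lemma (in group) mem_return_times:
  assumes "dynamical_system X G \<Phi>" "U \<subseteq> topspace X" "V \<subseteq> topspace X"
  shows "g \<in> return_times G \<Phi> U V \<longleftrightarrow> g \<in> carrier G \<and> g \<noteq> \<one> \<and> (\<exists>x\<in>U. \<Phi> g x \<in> V)"
proof -
  have "U \<inter> \<Phi> (inv g) ` V \<noteq> {} \<longleftrightarrow> (\<exists>x\<in>U. \<Phi> g x \<in> V)" if "g \<in> carrier G"
  proof
    assume "U \<inter> \<Phi> (inv g) ` V \<noteq> {}"
    then show "\<exists>x\<in>U. \<Phi> g x \<in> V"
      using dynamical_system_inv(1)[OF assms(1) that] assms(3) by (force simp: subset_iff)
  next
    assume "\<exists>x\<in>U. \<Phi> g x \<in> V"
    then obtain x where x: "x \<in> U" "\<Phi> g x \<in> V"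
      by blast
    then have "x = \<Phi> (inv g) (\<Phi> g x)"
      using dynamical_system_inv(2)[OF assms(1) that] assms(2) by (simp add: subset_iff)
    with x show "U \<inter> \<Phi> (inv g) ` V \<noteq> {}"
      by blast
  qed
  then show ?thesis
    by (auto simp: return_times_def)
qed

section \<open>The four properties in terms of return times\<close>

definition nonempty_open :: "'x topology \<Rightarrow> 'x set \<Rightarrow> bool" where
  "nonempty_open X U \<longleftrightarrow> openin X U \<and> U \<noteq> {}"

lemma return_times_mono:
  "U \<subseteq> U' \<Longrightarrow> V \<subseteq> V' \<Longrightarrow> return_times G \<Phi> U V \<subseteq> return_times G \<Phi> U' V'"
  unfolding return_times_def by blast

lemma return_times_Times:
  "return_times G (\<lambda>g. map_prod (\<Phi> g) (\<Phi> g)) (U1 \<times> U2) (V1 \<times> V2) =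
   return_times G \<Phi> U1 V1 \<inter> return_times G \<Phi> U2 V2"
  unfolding return_times_def by (auto simp: map_prod_surj_on)

text \<open>Open boxes form a base of the product, and return times of boxes are intersections. This
  moves weak mixing from the square to \<open>X\<close> itself, where it can be treated together
  with the other properties.\<close>

lemma weakly_mixing_iff:
  "weakly_mixing_system X G \<Phi> \<longleftrightarrow>
     (\<forall>U1 V1 U2 V2. nonempty_open X U1 \<and> nonempty_open X V1 \<and> nonempty_open X U2 \<and> nonempty_open X V2
        \<longrightarrow> infinite (return_times G \<Phi> U1 V1 \<inter> return_times G \<Phi> U2 V2))"
  (is "?L \<longleftrightarrow> ?R")
proof
  assume L: ?L
  show ?R
  proof (intro allI impI)
    fix U1 V1 U2 V2
    assume "nonempty_open X U1 \<and> nonempty_open X V1 \<and> nonempty_open X U2 \<and> nonempty_open X V2"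
    then have "infinite (return_times G (\<lambda>g. map_prod (\<Phi> g) (\<Phi> g)) (U1 \<times> U2) (V1 \<times> V2))"
      using L[unfolded weakly_mixing_system_def transitive_system_def, rule_format, of "U1 \<times> U2" "V1 \<times> V2"]
      by (auto simp: nonempty_open_def openin_prod_Times_iff)
    then show "infinite (return_times G \<Phi> U1 V1 \<inter> return_times G \<Phi> U2 V2)"
      by (simp add: return_times_Times)
  qed
next
  assume R: ?R
  have box: "\<exists>U1 U2. nonempty_open X U1 \<and> nonempty_open X U2 \<and> U1 \<times> U2 \<subseteq> W"
    if "openin (prod_topology X X) W" "W \<noteq> {}" for W
  proof -
    obtain x y where "(x, y) \<in> W"
      using \<open>W \<noteq> {}\<close> by auto
    then obtain U1 U2 where "openin X U1" "openin X U2" "x \<in> U1" "y \<in> U2" "U1 \<times> U2 \<subseteq> W"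
      using \<open>openin (prod_topology X X) W\<close>[unfolded openin_prod_topology_alt, rule_format, of x y]
      by auto
    then show ?thesis
      by (intro exI[of _ U1] exI[of _ U2]) (auto simp: nonempty_open_def)
  qed
  show ?L
    unfolding weakly_mixing_system_def transitive_system_def
  proof (intro allI impI, elim conjE)
    fix U V
    assume UV: "openin (prod_topology X X) U" "openin (prod_topology X X) V" "U \<noteq> {}" "V \<noteq> {}"
    obtain U1 U2 where U: "nonempty_open X U1" "nonempty_open X U2" "U1 \<times> U2 \<subseteq> U"
      using box[OF UV(1,3)] by blast
    obtain V1 V2 where V: "nonempty_open X V1" "nonempty_open X V2" "V1 \<times> V2 \<subseteq> V"
      using box[OF UV(2,4)] by blast
    have "infinite (return_times G \<Phi> U1 V1 \<inter> return_times G \<Phi> U2 V2)"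
      using U V R[rule_format, of U1 V1 U2 V2] by simp
    moreover have "return_times G \<Phi> U1 V1 \<inter> return_times G \<Phi> U2 V2
             \<subseteq> return_times G (\<lambda>g. map_prod (\<Phi> g) (\<Phi> g)) U V"
      unfolding return_times_Times[symmetric]
      by (rule return_times_mono) fact+
    ultimately show "infinite (return_times G (\<lambda>g. map_prod (\<Phi> g) (\<Phi> g)) U V)"
      using infinite_super by blast
  qed
qed

text \<open>Each property says that a return time set, or the intersection of two of them, is large
  in a sense inherited by supersets. Weak mixing is the reason for treating two pairs at once: both
  must be refined in the same system \<open>X i\<close>. The index may vary because in an inverse
  limit the suitable level depends on the open sets.\<close>

lemma has_property_transfer:
  assumes has_P: "\<And>i. i \<in> I \<Longrightarrow> has_property P (X i) G (\<Phi> i)"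
    and refine: "\<And>U1 V1 U2 V2. nonempty_open Y U1 \<Longrightarrow> nonempty_open Y V1 \<Longrightarrow>
      nonempty_open Y U2 \<Longrightarrow> nonempty_open Y V2 \<Longrightarrow>
      \<exists>i\<in>I. \<exists>U1' V1' U2' V2'. nonempty_open (X i) U1' \<and> nonempty_open (X i) V1' \<and>
         nonempty_open (X i) U2' \<and> nonempty_open (X i) V2' \<and>
         return_times G (\<Phi> i) U1' V1' \<subseteq> return_times G \<Psi> U1 V1 \<and>
         return_times G (\<Phi> i) U2' V2' \<subseteq> return_times G \<Psi> U2 V2"
  shows "has_property P Y G \<Psi>"
proof -
  have refine1: "\<exists>i\<in>I. \<exists>U' V'. nonempty_open (X i) U' \<and> nonempty_open (X i) V' \<and>
      return_times G (\<Phi> i) U' V' \<subseteq> return_times G \<Psi> U V"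
    if "nonempty_open Y U" "nonempty_open Y V" for U V
    using refine[OF that that] by blast
  show ?thesis
  proof (cases P)
    case Transitivity
    show ?thesis
      unfolding Transitivity has_property.simps transitive_system_def
    proof (intro allI impI)
      fix U V assume "openin Y U \<and> openin Y V \<and> U \<noteq> {} \<and> V \<noteq> {}"
      then obtain i U' V' where i: "i \<in> I" "nonempty_open (X i) U'" "nonempty_open (X i) V'"
          and sub: "return_times G (\<Phi> i) U' V' \<subseteq> return_times G \<Psi> U V"
        using refine1[of U V] by (auto simp: nonempty_open_def)
      have "infinite (return_times G (\<Phi> i) U' V')"
        using has_P[OF i(1)] i by (simp add: Transitivity transitive_system_def nonempty_open_def)
      then show "infinite (return_times G \<Psi> U V)"
        using sub infinite_super by blast
    qed
  next
    case Total_Transitivity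
    show ?thesis
      unfolding Total_Transitivity has_property.simps totally_transitive_system_def
    proof (intro allI impI)
      fix K U V assume K: "K \<subseteq> carrier G \<and> countable K \<and> \<not> K \<subseteq> {\<one>\<^bsub>G\<^esub>}"
        and "openin Y U \<and> openin Y V \<and> U \<noteq> {} \<and> V \<noteq> {}"
      then obtain i U' V' where i: "i \<in> I" "nonempty_open (X i) U'" "nonempty_open (X i) V'"
          and sub: "return_times G (\<Phi> i) U' V' \<subseteq> return_times G \<Psi> U V"
        using refine1[of U V] by (auto simp: nonempty_open_def)
      have "return_times G (\<Phi> i) U' V' \<inter> generate G K \<noteq> {}"
        using has_P[OF i(1)] i K
        by (simp add: Total_Transitivity totally_transitive_system_def nonempty_open_def)
      then show "return_times G \<Psi> U V \<inter> generate G K \<noteq> {}"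
        using sub by blast
    qed
  next
    case Weak_Mixing
    show ?thesis
      unfolding Weak_Mixing has_property.simps weakly_mixing_iff
    proof (intro allI impI, elim conjE)
      fix U1 V1 U2 V2
      assume "nonempty_open Y U1" "nonempty_open Y V1" "nonempty_open Y U2" "nonempty_open Y V2"
      from refine[OF this] obtain i U1' V1' U2' V2' where i: "i \<in> I"
          and o: "nonempty_open (X i) U1'" "nonempty_open (X i) V1'" "nonempty_open (X i) U2'" "nonempty_open (X i) V2'"
          and sub: "return_times G (\<Phi> i) U1' V1' \<subseteq> return_times G \<Psi> U1 V1"
            "return_times G (\<Phi> i) U2' V2' \<subseteq> return_times G \<Psi> U2 V2"
        by blast
      have "infinite (return_times G (\<Phi> i) U1' V1' \<inter> return_times G (\<Phi> i) U2' V2')"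
        using has_P[OF i] o by (simp add: Weak_Mixing weakly_mixing_iff)
      then show "infinite (return_times G \<Psi> U1 V1 \<inter> return_times G \<Psi> U2 V2)"
        using Int_mono[OF sub] infinite_super by blast
    qed
  next
    case Mixing
    show ?thesis
      unfolding Mixing has_property.simps mixing_system_def
    proof (intro allI impI)
      fix U V assume "openin Y U \<and> openin Y V \<and> U \<noteq> {} \<and> V \<noteq> {}"
      then obtain i U' V' where i: "i \<in> I" "nonempty_open (X i) U'" "nonempty_open (X i) V'"
          and sub: "return_times G (\<Phi> i) U' V' \<subseteq> return_times G \<Psi> U V"
        using refine1[of U V] by (auto simp: nonempty_open_def)
      have "finite (carrier G - return_times G (\<Phi> i) U' V')"
        using has_P[OF i(1)] i by (simp add: Mixing mixing_system_def nonempty_open_def)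
      then show "finite (carrier G - return_times G \<Psi> U V)"
        by (rule rev_finite_subset) (use sub in blast)
    qed
  qed
qed

text \<open>The set \<open>D\<close> need not be closed: it will be the set of points with generic orbit, on which
  the itinerary maps are continuous.\<close>

lemma (in group) has_property_dense_image:
  assumes X: "dynamical_system X G \<Phi>" and Y: "dynamical_system Y G \<Psi>"
    and D: "D \<subseteq> topspace X" "X closure_of D = topspace X"
      "\<And>g x. g \<in> carrier G \<Longrightarrow> x \<in> D \<Longrightarrow> \<Phi> g x \<in> D"
    and f: "continuous_map (subtopology X D) Y f" "Y closure_of (f ` D) = topspace Y"
      "\<And>g x. g \<in> carrier G \<Longrightarrow> x \<in> D \<Longrightarrow> f (\<Phi> g x) = \<Psi> g (f x)"
    and P: "has_property P X G \<Phi>"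
  shows "has_property P Y G \<Psi>"
proof -
  have pull: "\<exists>U'. nonempty_open X U' \<and> (\<forall>x\<in>D \<inter> U'. f x \<in> U)" if U: "nonempty_open Y U" for U
  proof -
    have "openin (subtopology X D) {x \<in> topspace (subtopology X D). f x \<in> U}"
      using U openin_continuous_map_preimage[OF f(1)] unfolding nonempty_open_def by blast
    then obtain U' where U': "openin X U'" "{x \<in> topspace (subtopology X D). f x \<in> U} = U' \<inter> D"
      by (auto simp: openin_subtopology)
    \<comment> \<open>Density of the image puts a point of \<open>D\<close> over \<open>U\<close>,
      so that \<open>U'\<close> is not empty.\<close>
    have "f ` D \<inter> U \<noteq> {}"
      using U f(2) unfolding dense_intersects_open nonempty_open_def by blast
    then have "U' \<noteq> {}"
      using U' D(1) by auto
    then show ?thesis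
      using U' by (auto simp: nonempty_open_def)
  qed
  have refine: "return_times G \<Phi> U' V' \<subseteq> return_times G \<Psi> U V"
    if o: "nonempty_open Y U" "nonempty_open Y V" "nonempty_open X U'" "nonempty_open X V'"
      and U': "\<forall>x\<in>D \<inter> U'. f x \<in> U" and V': "\<forall>x\<in>D \<inter> V'. f x \<in> V" for U V U' V'
  proof
    fix g assume g: "g \<in> return_times G \<Phi> U' V'"
    have sub: "U' \<subseteq> topspace X" "V' \<subseteq> topspace X" "U \<subseteq> topspace Y" "V \<subseteq> topspace Y"
      using o by (simp_all add: nonempty_open_def openin_subset)
    have gG: "g \<in> carrier G" "g \<noteq> \<one>" and "\<exists>x\<in>U'. \<Phi> g x \<in> V'"
      using g mem_return_times[OF X sub(1,2)] by blast+
    then have "U' \<inter> {x \<in> topspace X. \<Phi> g x \<in> V'} \<noteq> {}"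
      using sub by blast
    \<comment> \<open>The points of \<open>U'\<close> that enter \<open>V'\<close> at time
      \<open>g\<close> form a nonempty open set. The dense set \<open>D\<close> contains one of
      them, and it is on \<open>D\<close> that \<open>f\<close> is equivariant.\<close>
    moreover have "openin X (U' \<inter> {x \<in> topspace X. \<Phi> g x \<in> V'})"
      using o openin_continuous_map_preimage[OF dynamical_system_closed(1)[OF X gG(1)]]
      by (intro openin_Int) (auto simp: nonempty_open_def)
    ultimately obtain x where "x \<in> D" "x \<in> U'" "\<Phi> g x \<in> V'"
      using D(2) unfolding dense_intersects_open by blast
    then have "f x \<in> U" "\<Psi> g (f x) \<in> V"
      using U' V' D(3)[OF gG(1)] f(3)[OF gG(1)] by (auto simp flip: f(3)[OF gG(1)])
    then show "g \<in> return_times G \<Psi> U V"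
      using mem_return_times[OF Y sub(3,4)] gG by blast
  qed
  show ?thesis
  proof (rule has_property_transfer[where I = "{()}" and X = "\<lambda>_. X" and \<Phi> = "\<lambda>_. \<Phi>"])
    fix U1 V1 U2 V2
    assume o: "nonempty_open Y U1" "nonempty_open Y V1" "nonempty_open Y U2" "nonempty_open Y V2"
    obtain U1' V1' U2' V2' where
      "nonempty_open X U1'" "\<forall>x\<in>D \<inter> U1'. f x \<in> U1" "nonempty_open X V1'" "\<forall>x\<in>D \<inter> V1'. f x \<in> V1"
      "nonempty_open X U2'" "\<forall>x\<in>D \<inter> U2'. f x \<in> U2" "nonempty_open X V2'" "\<forall>x\<in>D \<inter> V2'. f x \<in> V2"
      using o pull by metis
    with o show "\<exists>i\<in>{()}. \<exists>U1' V1' U2' V2'. nonempty_open X U1' \<and> nonempty_open X V1' \<and>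
         nonempty_open X U2' \<and> nonempty_open X V2' \<and>
         return_times G \<Phi> U1' V1' \<subseteq> return_times G \<Psi> U1 V1 \<and>
         return_times G \<Phi> U2' V2' \<subseteq> return_times G \<Psi> U2 V2"
      by (intro bexI[of _ "()"] exI[of _ U1'] exI[of _ V1'] exI[of _ U2'] exI[of _ V2'] conjI refine) auto
  qed (use P in simp)
qed

text \<open>The case of the previous lemma in which \<open>D\<close> is the whole space.\<close>

lemma (in group) has_property_factor:
  assumes "dynamical_system X G \<Phi>" "dynamical_system Y G \<Psi>"
    and "is_factor G Y \<Psi> X \<Phi>" "has_property P X G \<Phi>"
  shows "has_property P Y G \<Psi>"
proof -
  obtain f where f: "continuous_map X Y f" "f ` topspace X = topspace Y"
      "\<forall>g\<in>carrier G. \<forall>z\<in>topspace X. \<Psi> g (f z) = f (\<Phi> g z)"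
    using assms(3) by (auto simp: is_factor_def)
  show ?thesis
  proof (rule has_property_dense_image[OF assms(1,2)])
    show "continuous_map (subtopology X (topspace X)) Y f"
      using f(1) by simp
    show "Y closure_of f ` topspace X = topspace Y"
      using f(2) by simp
    show "f (\<Phi> g x) = \<Psi> g (f x)" if "g \<in> carrier G" "x \<in> topspace X" for g x
      using f(3) that by simp
  qed (use assms(4) dynamical_system_closed[OF assms(1)] in simp_all)
qed


section \<open>Inverse limits\<close>

lemma closedin_Collect_ball:
  assumes "\<And>i. i \<in> I \<Longrightarrow> closedin T {z \<in> topspace T. Q i z}"
  shows "closedin T {z \<in> topspace T. \<forall>i\<in>I. Q i z}"
proof -
  \<comment> \<open>Inserting \<open>topspace T\<close> keeps the family nonempty when
    \<open>I\<close> is empty.\<close>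
  have "{z \<in> topspace T. \<forall>i\<in>I. Q i z} = \<Inter>(insert (topspace T) ((\<lambda>i. {z \<in> topspace T. Q i z}) ` I))"
    by blast
  moreover have "closedin T K" if "K \<in> insert (topspace T) ((\<lambda>i. {z \<in> topspace T. Q i z}) ` I)" for K
    using that assms closedin_topspace by blast
  ultimately show ?thesis
    using closedin_Inter by (metis (no_types, lifting) insert_not_empty)
qed

lemma closedin_Collect_imp:
  "(P \<Longrightarrow> closedin T {z \<in> topspace T. Q z}) \<Longrightarrow> closedin T {z \<in> topspace T. P \<longrightarrow> Q z}"
  by (cases P) simp_all

lemma directed_set_finite_upper_bound:
  assumes "directed_set L leq" "finite F" "F \<subseteq> L"
  shows "\<exists>u\<in>L. \<forall>l\<in>F. leq l u"
proof -
  have nonempty: "L \<noteq> {}"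
    and trans: "\<forall>l\<in>L. \<forall>m\<in>L. \<forall>n\<in>L. leq l m \<longrightarrow> leq m n \<longrightarrow> leq l n"
    and upper: "\<forall>l\<in>L. \<forall>m\<in>L. \<exists>n\<in>L. leq l n \<and> leq m n"
    using assms(1) unfolding directed_set_def by - (elim conjE, assumption)+
  show ?thesis
    using assms(2,3)
  proof (induction F rule: finite_induct)
    case empty
    then show ?case
      using nonempty by blast
  next
    case (insert l F)
    then obtain u where u: "u \<in> L" "\<forall>l\<in>F. leq l u"
      by blast
    obtain v where v: "v \<in> L" "leq l v" "leq u v"
      using upper[rule_format, of l u] insert.prems u(1) by blast
    have "leq k v" if "k \<in> F" for k
      using trans[rule_format, of k u v] insert.prems u v that by blast
    then show ?case
      using v by blast
  qed
qed

locale inverse_system_of_systems = group G for G :: "('g, 'b) monoid_scheme" (structure) +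
  fixes L :: "'l set" and leq :: "'l \<Rightarrow> 'l \<Rightarrow> bool" and X :: "'l \<Rightarrow> 'x topology"
    and \<Phi> :: "'l \<Rightarrow> 'g \<Rightarrow> 'x \<Rightarrow> 'x" and \<phi> :: "'l \<Rightarrow> 'l \<Rightarrow> 'x \<Rightarrow> 'x"
  assumes inverse_system: "inverse_system G L leq X \<Phi> \<phi>"
begin

abbreviation Z :: "('l \<Rightarrow> 'x) topology" where
  "Z \<equiv> inverse_limit L leq X \<phi>"

lemma directed: "directed_set L leq"
  using inverse_system unfolding inverse_system_def by (elim conjE)

lemma leq_refl: "l \<in> L \<Longrightarrow> leq l l"
  using directed unfolding directed_set_def by (elim conjE) (rule bspec)

lemma leq_trans:
  assumes "l \<in> L" "m \<in> L" "n \<in> L" "leq l m" "leq m n"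
  shows "leq l n"
proof -
  have "\<forall>l\<in>L. \<forall>m\<in>L. \<forall>n\<in>L. leq l m \<longrightarrow> leq m n \<longrightarrow> leq l n"
    using directed unfolding directed_set_def by (elim conjE)
  from this[rule_format, OF assms] show ?thesis .
qed

lemma upper_bound: "l \<in> L \<Longrightarrow> m \<in> L \<Longrightarrow> \<exists>n\<in>L. leq l n \<and> leq m n"
  using directed_set_finite_upper_bound[OF directed, of "{l, m}"] by simp

lemma system: "l \<in> L \<Longrightarrow> dynamical_system (X l) G (\<Phi> l)"
  using inverse_system unfolding inverse_system_def by (elim conjE) (rule bspec)

lemma compact: "l \<in> L \<Longrightarrow> compact_space (X l)" and Hausdorff: "l \<in> L \<Longrightarrow> Hausdorff_space (X l)"
  using system by (simp_all add: dynamical_system_def)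

lemma bonding_continuous:
  assumes "l \<in> L" "m \<in> L" "leq l m"
  shows "continuous_map (X m) (X l) (\<phi> l m)"
proof -
  have "\<forall>l\<in>L. \<forall>m\<in>L. leq l m \<longrightarrow> continuous_map (X m) (X l) (\<phi> l m)"
    using inverse_system unfolding inverse_system_def by (elim conjE)
  from this[rule_format, OF assms] show ?thesis .
qed

lemma bonding_refl:
  assumes "l \<in> L" "x \<in> topspace (X l)"
  shows "\<phi> l l x = x"
proof -
  have "\<forall>l\<in>L. \<forall>x\<in>topspace (X l). \<phi> l l x = x"
    using inverse_system unfolding inverse_system_def by (elim conjE)
  from this[rule_format, OF assms] show ?thesis .
qed

lemma bonding_closed:
  "l \<in> L \<Longrightarrow> m \<in> L \<Longrightarrow> leq l m \<Longrightarrow> x \<in> topspace (X m) \<Longrightarrow> \<phi> l m x \<in> topspace (X l)"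
  using bonding_continuous[of l m] by (auto simp: continuous_map_def)

lemma bonding_comp:
  assumes "l \<in> L" "m \<in> L" "n \<in> L" "leq l m" "leq m n" "x \<in> topspace (X n)"
  shows "\<phi> l m (\<phi> m n x) = \<phi> l n x"
proof -
  have "\<forall>l\<in>L. \<forall>m\<in>L. \<forall>n\<in>L. leq l m \<longrightarrow> leq m n \<longrightarrow> (\<forall>x\<in>topspace (X n). \<phi> l n x = \<phi> l m (\<phi> m n x))"
    using inverse_system unfolding inverse_system_def by (elim conjE)
  from this[rule_format, OF assms] show ?thesis
    by (rule sym)
qed

lemma bonding_equivariant:
  assumes "l \<in> L" "m \<in> L" "leq l m" "g \<in> carrier G" "x \<in> topspace (X m)"
  shows "\<Phi> l g (\<phi> l m x) = \<phi> l m (\<Phi> m g x)"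
proof -
  have "\<forall>l\<in>L. \<forall>m\<in>L. leq l m \<longrightarrow>
        (\<forall>g\<in>carrier G. \<forall>x\<in>topspace (X m). \<Phi> l g (\<phi> l m x) = \<phi> l m (\<Phi> m g x))"
    using inverse_system unfolding inverse_system_def by (elim conjE)
  from this[rule_format, OF assms] show ?thesis .
qed

lemma in_limit_iff:
  "z \<in> topspace Z \<longleftrightarrow>
     z \<in> (\<Pi>\<^sub>E l\<in>L. topspace (X l)) \<and> (\<forall>l\<in>L. \<forall>m\<in>L. leq l m \<longrightarrow> \<phi> l m (z m) = z l)"
  unfolding inverse_limit_def topspace_subtopology topspace_product_topology o_def
    Int_absorb1[OF Collect_subset] mem_Collect_eq
  by (intro conj_cong refl ball_cong imp_cong eq_commute)

lemma limit_coordinate: "z \<in> topspace Z \<Longrightarrow> l \<in> L \<Longrightarrow> z l \<in> topspace (X l)"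
  by (auto simp: in_limit_iff)

lemma limit_bonding: "z \<in> topspace Z \<Longrightarrow> l \<in> L \<Longrightarrow> m \<in> L \<Longrightarrow> leq l m \<Longrightarrow> \<phi> l m (z m) = z l"
  by (auto simp: in_limit_iff)

lemma projection_continuous: "l \<in> L \<Longrightarrow> continuous_map Z (X l) (\<lambda>z. z l)"
  unfolding inverse_limit_def
  by (rule continuous_map_from_subtopology) (rule continuous_map_product_projection)

section \<open>Topology and action of the inverse limit\<close>

lemma closedin_compatible:
  assumes "l \<in> L" "m \<in> L" "leq l m"
  shows "closedin (product_topology X L) {z \<in> topspace (product_topology X L). z l = \<phi> l m (z m)}"
proof (rule closedin_continuous_maps_eq[OF Hausdorff[OF assms(1)]])
  show "continuous_map (product_topology X L) (X l) (\<lambda>z. z l)"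
    using assms(1) by (rule continuous_map_product_projection)
  show "continuous_map (product_topology X L) (X l) (\<lambda>z. \<phi> l m (z m))"
    using continuous_map_compose[of "product_topology X L" "X m" "\<lambda>z. z m" "X l" "\<phi> l m"]
      continuous_map_product_projection[OF assms(2), of X] bonding_continuous[OF assms]
    by (simp add: o_def)
qed

lemma closedin_limit:
  "closedin (product_topology X L)
     {z \<in> \<Pi>\<^sub>E l\<in>L. topspace (X l). \<forall>l\<in>L. \<forall>m\<in>L. leq l m \<longrightarrow> z l = \<phi> l m (z m)}" (is "closedin ?P ?S")
proof -
  have "closedin ?P {z \<in> topspace ?P. \<forall>l\<in>L. \<forall>m\<in>L. leq l m \<longrightarrow> z l = \<phi> l m (z m)}"
    by (intro closedin_Collect_ball closedin_Collect_imp closedin_compatible)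
  then show ?thesis
    unfolding topspace_product_topology o_def .
qed

lemma limit_compact: "compact_space Z"
  unfolding inverse_limit_def
  by (intro compact_space_subtopology closedin_compact_space closedin_limit)
     (simp add: compact_space_product_topology compact)

lemma limit_Hausdorff: "Hausdorff_space Z"
  unfolding inverse_limit_def
  by (intro Hausdorff_space_subtopology) (simp add: Hausdorff_space_product_topology Hausdorff)

lemma action_closed:
  assumes "g \<in> carrier G" "z \<in> topspace Z"
  shows "coordinatewise_action L \<Phi> g z \<in> topspace Z"
proof -
  have "\<Phi> l g (z l) \<in> topspace (X l)" if "l \<in> L" for l
    using dynamical_system_closed(2)[OF system[OF that] assms(1)] limit_coordinate[OF assms(2) that] .
  moreover have "\<phi> l m (\<Phi> m g (z m)) = \<Phi> l g (z l)" if "l \<in> L" "m \<in> L" "leq l m" for l m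
    using bonding_equivariant[OF that assms(1) limit_coordinate[OF assms(2) that(2)]]
      limit_bonding[OF assms(2) that] by simp
  ultimately show ?thesis
    unfolding in_limit_iff by (simp add: coordinatewise_action_def)
qed

lemma limit_dynamical_system: "dynamical_system Z G (coordinatewise_action L \<Phi>)"
proof (rule dynamical_systemI)
  fix g assume g: "g \<in> carrier G"
  have "continuous_map Z (X l) (\<lambda>z. \<Phi> l g (z l))" if "l \<in> L" for l
    using continuous_map_compose[of Z "X l" "\<lambda>z. z l" "X l" "\<Phi> l g"]
      projection_continuous[OF that] dynamical_system_closed(1)[OF system[OF that] g] by (simp add: o_def)
  then have "continuous_map Z (product_topology X L) (coordinatewise_action L \<Phi> g)"
    unfolding continuous_map_componentwise by (simp add: coordinatewise_action_def image_subset_iff)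
  then show "continuous_map Z Z (coordinatewise_action L \<Phi> g)"
    using action_closed[OF g] unfolding inverse_limit_def continuous_map_in_subtopology
    by (simp add: Pi_iff)
next
  fix z assume z: "z \<in> topspace Z"
  have "\<Phi> l \<one> (z l) = z l" if "l \<in> L" for l
    using system[OF that] limit_coordinate[OF z that] by (simp add: dynamical_system_def)
  moreover have "z \<in> extensional L"
    using z by (simp add: in_limit_iff PiE_iff)
  ultimately show "coordinatewise_action L \<Phi> \<one> z = z"
    by (intro extensionalityI[of _ L]) (simp_all add: coordinatewise_action_def)
next
  fix g h z assume gh: "g \<in> carrier G" "h \<in> carrier G" and z: "z \<in> topspace Z"
  have "\<Phi> l (g \<otimes> h) (z l) = \<Phi> l g (\<Phi> l h (z l))" if "l \<in> L" for l
    using system[OF that] limit_coordinate[OF z that] gh by (simp add: dynamical_system_def)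
  then show "coordinatewise_action L \<Phi> (g \<otimes> h) z = coordinatewise_action L \<Phi> g (coordinatewise_action L \<Phi> h z)"
    by (simp add: coordinatewise_action_def cong: restrict_cong)
qed (rule limit_compact limit_Hausdorff)+

text \<open>Since \<open>L\<close> is directed, sets depending on a single coordinate already form a base.\<close>

lemma limit_base:
  assumes "openin Z U" "z \<in> U"
  shows "\<exists>l\<in>L. \<exists>W. openin (X l) W \<and> z l \<in> W \<and> (\<forall>y\<in>topspace Z. y l \<in> W \<longrightarrow> y \<in> U)"
proof -
  obtain T where T: "openin (product_topology X L) T" "U = T \<inter> topspace Z"
  proof -
    obtain T where "openin (product_topology X L) T" "U = T \<inter> topspace Z"
      using assms(1) openin_subset[OF assms(1)] unfolding inverse_limit_def openin_subtopology by auto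
    then show ?thesis
      by (rule that)
  qed
  then obtain W where fin: "finite {l \<in> L. W l \<noteq> topspace (X l)}"
      and W: "\<forall>l\<in>L. openin (X l) (W l)" "z \<in> Pi\<^sub>E L W" "Pi\<^sub>E L W \<subseteq> T"
    using assms(2) unfolding openin_product_topology_alt by blast
  \<comment> \<open>\<open>F\<close> collects the finitely many coordinates that the box restricts.
    All their conditions are pulled back to one common upper bound \<open>u\<close>.\<close>
  define F where "F = {l \<in> L. W l \<noteq> topspace (X l)}"
  obtain u where u: "u \<in> L" "\<forall>l\<in>F. leq l u"
    using directed_set_finite_upper_bound[OF directed, of F] fin by (auto simp: F_def)
  have z: "z \<in> topspace Z"
    using assms openin_subset by blast
  define V where "V = \<Inter>(insert (topspace (X u)) ((\<lambda>l. {x \<in> topspace (X u). \<phi> l u x \<in> W l}) ` F))"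
  have "openin (X u) V"
    unfolding V_def
  proof (rule openin_Inter)
    have "openin (X u) {x \<in> topspace (X u). \<phi> l u x \<in> W l}" if "l \<in> F" for l
      using that u W(1) by (intro openin_continuous_map_preimage[OF bonding_continuous]) (simp_all add: F_def)
    then show "openin (X u) K" if "K \<in> insert (topspace (X u)) ((\<lambda>l. {x \<in> topspace (X u). \<phi> l u x \<in> W l}) ` F)" for K
      using that by auto
  qed (use fin in \<open>simp_all add: F_def\<close>)
  moreover have "z u \<in> V"
  proof -
    have "\<phi> l u (z u) \<in> W l" if "l \<in> F" for l
      using that u W(2) limit_bonding[OF z _ u(1), of l] by (simp add: F_def PiE_iff)
    then show ?thesis
      using limit_coordinate[OF z u(1)] by (simp add: V_def)
  qed
  moreover have "y \<in> U" if y: "y \<in> topspace Z" "y u \<in> V" for y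
  proof -
    have "y l \<in> W l" if "l \<in> L" for l
    proof (cases "l \<in> F")
      case True
      then show ?thesis
        using y(2) u(2) limit_bonding[OF y(1) that u(1)] by (force simp: V_def)
    next
      case False
      then show ?thesis
        using that limit_coordinate[OF y(1) that] by (simp add: F_def)
    qed
    moreover have "y \<in> extensional L"
      using y(1) by (simp add: in_limit_iff PiE_iff)
    ultimately have "y \<in> Pi\<^sub>E L W"
      by (simp add: PiE_iff)
    then show ?thesis
      using T(2) W(3) y(1) by blast
  qed
  ultimately show ?thesis
    by (intro bexI[OF _ u(1)] exI[of _ V] conjI ballI impI)
qed

text \<open>Compactness: the threads through \<open>x\<close> are the points common to the closed sets \<open>C n\<close>
  of families that are compatible below \<open>n\<close>.\<close>

lemma stable_point_lifts:
  assumes l: "l \<in> L" and x: "\<And>n. n \<in> L \<Longrightarrow> leq l n \<Longrightarrow> x \<in> \<phi> l n ` topspace (X n)"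
  shows "\<exists>z\<in>topspace Z. z l = x"
proof -
  let ?P = "product_topology X L"
  define C where "C n = {z \<in> topspace ?P. z l = x \<and> (\<forall>k\<in>L. leq k n \<longrightarrow> z k = \<phi> k n (z n))}" for n
  have xl: "x \<in> topspace (X l)"
    using x[OF l leq_refl[OF l]] bonding_closed[OF l l leq_refl[OF l]] by auto
  \<comment> \<open>Above both \<open>k\<close> and \<open>l\<close> there is a preimage of
    \<open>x\<close>, and a bonding map sends it to a point at \<open>k\<close>.\<close>
  have nonempty: "topspace (X k) \<noteq> {}" if k: "k \<in> L" for k
  proof -
    obtain n where "n \<in> L" "leq l n" "leq k n"
      using upper_bound[OF l k] by blast
    then show ?thesis
      using x[of n] bonding_closed[OF k, of n] by blast
  qed
  have C_nonempty: "C n \<noteq> {}" if n: "n \<in> L" "leq l n" for n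
  proof -
    obtain y where y: "y \<in> topspace (X n)" "x = \<phi> l n y"
      using x[OF n] by blast
    \<comment> \<open>Below \<open>n\<close> the family is the image of \<open>y\<close>; elsewhere
      its values are arbitrary, since \<open>C n\<close> puts no condition there.\<close>
    define z where "z = (\<lambda>k\<in>L. if leq k n then \<phi> k n y else SOME v. v \<in> topspace (X k))"
    have "z \<in> topspace ?P"
      using y n bonding_closed nonempty by (auto simp: z_def some_in_eq)
    moreover have "\<phi> n n y = y"
      using bonding_refl n y by simp
    ultimately have "z \<in> C n"
      using y n l leq_refl by (auto simp: C_def z_def)
    then show ?thesis
      by blast
  qed
  have C_antimono: "C n \<subseteq> C m" if "m \<in> L" "n \<in> L" "leq m n" for m n
  proof
    fix z assume z: "z \<in> C n"
    have "z k = \<phi> k m (z m)" if k: "k \<in> L" "leq k m" for k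
    proof -
      have "leq k n"
        using k \<open>m \<in> L\<close> \<open>n \<in> L\<close> \<open>leq m n\<close> leq_trans by blast
      then have "z k = \<phi> k n (z n)" "z m = \<phi> m n (z n)" "z n \<in> topspace (X n)"
        using z k \<open>m \<in> L\<close> \<open>n \<in> L\<close> \<open>leq m n\<close> by (auto simp: C_def)
      then show ?thesis
        using k \<open>m \<in> L\<close> \<open>n \<in> L\<close> \<open>leq m n\<close> bonding_comp by simp
    qed
    then show "z \<in> C m"
      using z by (auto simp: C_def)
  qed
  have C_closed: "closedin ?P (C n)" if n: "n \<in> L" for n
  proof -
    let ?K = "(\<lambda>k. {z \<in> topspace ?P. z k = \<phi> k n (z n)}) ` {k \<in> L. leq k n}"
    have "closedin ?P {z \<in> topspace ?P. z l \<in> {x}}"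
      using l xl Hausdorff[OF l]
      by (intro closedin_continuous_map_preimage[OF continuous_map_product_projection closedin_Hausdorff_singleton])
    then have "closedin ?P (\<Inter>(insert {z \<in> topspace ?P. z l \<in> {x}} ?K))"
      using closedin_compatible n by (intro closedin_Inter) (auto simp del: topspace_product_topology)
    moreover have "\<Inter>(insert {z \<in> topspace ?P. z l \<in> {x}} ?K) = C n"
      by (auto simp: C_def)
    ultimately show ?thesis
      by simp
  qed
  have fip: "\<Inter>\<F> \<noteq> {}" if \<F>: "finite \<F>" "\<F> \<subseteq> C ` L" for \<F>
  proof -
    obtain F where F: "finite F" "F \<subseteq> L" "\<F> = C ` F"
      using \<F> by (meson finite_subset_image)
    \<comment> \<open>\<open>l\<close> is included because \<open>C u\<close> is known to be
      nonempty only for \<open>u\<close> above \<open>l\<close>.\<close>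
    obtain u where u: "u \<in> L" "\<forall>k\<in>insert l F. leq k u"
      using directed_set_finite_upper_bound[OF directed, of "insert l F"] F l by auto
    have "C u \<subseteq> \<Inter>\<F>"
      using u F C_antimono by blast
    then show ?thesis
      using C_nonempty u by blast
  qed
  have "compact_space ?P"
    by (simp add: compact_space_product_topology compact)
  then have "\<Inter>(C ` L) \<noteq> {}"
    unfolding compact_space_fip by (elim allE[of _ "C ` L"] mp) (use C_closed fip in auto)
  then obtain z where z: "\<And>n. n \<in> L \<Longrightarrow> z \<in> C n"
    by blast
  \<comment> \<open>Lying in every \<open>C n\<close> means compatibility for all pairs of
    indices.\<close>
  have "z \<in> topspace Z" "z l = x"
    using z l by (auto simp: C_def in_limit_iff)
  then show ?thesis
    by blast
qed

text \<open>Nonempty open sets of the limit contain sets controlled by a single coordinate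
  \<open>l\<close>. At an index \<open>m\<close> where the images in \<open>X l\<close> have
  stabilized, every point of \<open>X m\<close> maps to a stable point of \<open>X l\<close>, which
  lifts to a thread. A return at level \<open>m\<close> thus yields one in the limit, even though
  the points of \<open>X m\<close> themselves need not lift.\<close>

lemma has_property_ML_limit:
  assumes stable: "Mittag_Leffler L leq X \<phi>" and P: "\<And>l. l \<in> L \<Longrightarrow> has_property P (X l) G (\<Phi> l)"
  shows "has_property P Z G (coordinatewise_action L \<Phi>)"
proof -
  \<comment> \<open>Projections of the limit need not be surjective, so nonemptiness of
    \<open>W\<close> would be too weak: \<open>W\<close> has to contain the coordinate of some
    thread. It then stays nonempty when pulled back to higher levels.\<close>
  define base where "base n U W \<longleftrightarrow> openin (X n) W \<and> (\<exists>y\<in>topspace Z. y n \<in> W) \<and>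
      (\<forall>y\<in>topspace Z. y n \<in> W \<longrightarrow> y \<in> U)" for n U W
  have base_lift: "base n U {x \<in> topspace (X n). \<phi> l n x \<in> W}"
    if "base l U W" "l \<in> L" "n \<in> L" "leq l n" for l n U W
  proof -
    have "openin (X l) W"
      using that(1) by (simp add: base_def)
    then have "openin (X n) {x \<in> topspace (X n). \<phi> l n x \<in> W}"
      by (rule openin_continuous_map_preimage[OF bonding_continuous[OF that(2-4)]])
    moreover have "y n \<in> topspace (X n) \<and> \<phi> l n (y n) = y l" if "y \<in> topspace Z" for y
      using limit_coordinate[OF that \<open>n \<in> L\<close>] limit_bonding[OF that \<open>l \<in> L\<close> \<open>n \<in> L\<close> \<open>leq l n\<close>] by simp
    ultimately show ?thesis
      using \<open>base l U W\<close> unfolding base_def by simp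
  qed
  have base_ex: "\<exists>l\<in>L. \<exists>W. base l U W" if U: "nonempty_open Z U" for U
  proof -
    obtain z where z: "z \<in> U" "z \<in> topspace Z"
      using U openin_subset unfolding nonempty_open_def by blast
    obtain l W where "l \<in> L" "openin (X l) W" "z l \<in> W" "\<forall>y\<in>topspace Z. y l \<in> W \<longrightarrow> y \<in> U"
      using limit_base[of U z] U z(1) by (auto simp: nonempty_open_def)
    then show ?thesis
      using z(2) unfolding base_def by blast
  qed
  have base_nonempty: "nonempty_open (X n) W" if "base n U W" for n U W
    using that by (auto simp: base_def nonempty_open_def)
  have subset: "return_times G (\<Phi> m) {x \<in> topspace (X m). \<phi> l m x \<in> U'} {x \<in> topspace (X m). \<phi> l m x \<in> V'}
      \<subseteq> return_times G (coordinatewise_action L \<Phi>) U V" (is "return_times G _ ?U' ?V' \<subseteq> _")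
    if l: "l \<in> L" "m \<in> L" "leq l m" "\<forall>n\<in>L. leq m n \<longrightarrow> \<phi> l n ` topspace (X n) = \<phi> l m ` topspace (X m)"
      and b: "base l U U'" "base l V V'" and o: "nonempty_open Z U" "nonempty_open Z V" for l m U V U' V'
  proof
    fix g assume "g \<in> return_times G (\<Phi> m) ?U' ?V'"
    then obtain x where g: "g \<in> carrier G" "g \<noteq> \<one>"
        and x: "x \<in> topspace (X m)" "\<phi> l m x \<in> U'" "\<phi> l m (\<Phi> m g x) \<in> V'"
      using mem_return_times[OF system[OF l(2)], of ?U' ?V' g] by blast
    \<comment> \<open>The stable image equals the image from any \<open>k\<close> above
      \<open>m\<close>. Taking \<open>k\<close> above \<open>n\<close> as well, that image factors
      through \<open>X n\<close>.\<close>
    have "\<phi> l m x \<in> \<phi> l n ` topspace (X n)" if n: "n \<in> L" "leq l n" for n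
    proof -
      obtain k where k: "k \<in> L" "leq m k" "leq n k"
        using upper_bound[OF l(2) n(1)] by blast
      then obtain w where w: "w \<in> topspace (X k)" "\<phi> l m x = \<phi> l k w"
        using l(4) x(1) by blast
      then have "\<phi> l m x = \<phi> l n (\<phi> n k w)" "\<phi> n k w \<in> topspace (X n)"
        using bonding_comp[OF l(1) n(1) k(1) n(2) k(3)] bonding_closed[OF n(1) k(1,3)] by simp_all
      then show ?thesis
        by blast
    qed
    then obtain z where z: "z \<in> topspace Z" "z l = \<phi> l m x"
      using stable_point_lifts[OF l(1)] by blast
    have "z \<in> U"
      using b(1) x(2) z by (simp add: base_def)
    moreover have "coordinatewise_action L \<Phi> g z l = \<phi> l m (\<Phi> m g x)"
      using bonding_equivariant[OF l(1-3) g(1) x(1)] z(2) l(1) by (simp add: coordinatewise_action_def)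
    then have "coordinatewise_action L \<Phi> g z \<in> V"
      using b(2) x(3) action_closed[OF g(1) z(1)] by (simp add: base_def)
    ultimately show "g \<in> return_times G (coordinatewise_action L \<Phi>) U V"
      using mem_return_times[OF limit_dynamical_system, of U V g] g o openin_subset
      unfolding nonempty_open_def by blast
  qed
  show ?thesis
  proof (rule has_property_transfer[OF P])
    fix U1 V1 U2 V2
    assume o: "nonempty_open Z U1" "nonempty_open Z V1" "nonempty_open Z U2" "nonempty_open Z V2"
    obtain l1 l2 l3 l4 A1 B1 A2 B2 where l: "l1 \<in> L" "l2 \<in> L" "l3 \<in> L" "l4 \<in> L" and
      b: "base l1 U1 A1" "base l2 V1 B1" "base l3 U2 A2" "base l4 V2 B2"
      using base_ex[OF o(1)] base_ex[OF o(2)] base_ex[OF o(3)] base_ex[OF o(4)] by (elim bexE exE) (rule that)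
    obtain l where lL: "l \<in> L" and lub: "leq l1 l" "leq l2 l" "leq l3 l" "leq l4 l"
      using directed_set_finite_upper_bound[OF directed, of "{l1, l2, l3, l4}"] l by auto
    \<comment> \<open>The four sets are first brought to a common level \<open>l\<close> and then to
      its stabilizing index \<open>m\<close>. The sets in \<open>b''\<close> are preimages of those
      in \<open>b'\<close>, as \<open>subset\<close> requires.\<close>
    note b' = base_lift[OF b(1) l(1) lL lub(1)] base_lift[OF b(2) l(2) lL lub(2)]
      base_lift[OF b(3) l(3) lL lub(3)] base_lift[OF b(4) l(4) lL lub(4)]
    obtain m where m: "m \<in> L" "leq l m" "\<forall>n\<in>L. leq m n \<longrightarrow> \<phi> l n ` topspace (X n) = \<phi> l m ` topspace (X m)"
      using stable lL unfolding Mittag_Leffler_def by blast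
    note b'' = b'[THEN base_lift, OF lL m(1,2)]
    show "\<exists>i\<in>L. \<exists>U1' V1' U2' V2'. nonempty_open (X i) U1' \<and> nonempty_open (X i) V1' \<and>
         nonempty_open (X i) U2' \<and> nonempty_open (X i) V2' \<and>
         return_times G (\<Phi> i) U1' V1' \<subseteq> return_times G (coordinatewise_action L \<Phi>) U1 V1 \<and>
         return_times G (\<Phi> i) U2' V2' \<subseteq> return_times G (coordinatewise_action L \<Phi>) U2 V2"
      by (intro bexI[OF _ m(1)] exI conjI)
         (rule base_nonempty[OF b''(1)] base_nonempty[OF b''(2)] base_nonempty[OF b''(3)] base_nonempty[OF b''(4)]
           subset[OF lL m b'(1,2) o(1,2)] subset[OF lL m b'(3,4) o(3,4)])+
  qed
qed

end


section \<open>Subshifts\<close>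

lemma topspace_full_shift [simp]: "topspace (full_shift G A) = (\<Pi>\<^sub>E g\<in>carrier G. A)"
  by (simp add: full_shift_def)

lemma full_shift_compact: "finite A \<Longrightarrow> compact_space (full_shift G A)"
  by (simp add: full_shift_def compact_space_product_topology compact_space_discrete_topology)

lemma full_shift_Hausdorff: "Hausdorff_space (full_shift G A)"
  by (simp add: full_shift_def Hausdorff_space_product_topology)

lemma full_shift_coordinate:
  "g \<in> carrier G \<Longrightarrow> continuous_map (full_shift G A) (discrete_topology A) (\<lambda>s. s g)"
  unfolding full_shift_def by (rule continuous_map_product_projection)

lemma continuous_map_full_shiftI:
  assumes "\<And>x g. x \<in> topspace T \<Longrightarrow> g \<notin> carrier G \<Longrightarrow> f x g = undefined"
    and "\<And>g. g \<in> carrier G \<Longrightarrow> continuous_map T (discrete_topology A) (\<lambda>x. f x g)"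
  shows "continuous_map T (full_shift G A) f"
  unfolding full_shift_def continuous_map_componentwise
  using assms by (auto simp: extensional_def)

lemma (in group) shift_continuous:
  "g \<in> carrier G \<Longrightarrow> continuous_map (full_shift G A) (full_shift G A) (shift G g)"
  by (rule continuous_map_full_shiftI) (simp_all add: shift_def full_shift_coordinate)

lemma topspace_subshift_space:
  assumes "subshift G A S"
  shows "topspace (subshift_space G A S) = S"
  using closedin_subset[of "full_shift G A" S] assms
  by (simp add: subshift_def subshift_space_def Int_absorb1)

lemma (in group) subshift_dynamical_system:
  assumes "subshift G A S"
  shows "dynamical_system (subshift_space G A S) G (shift G)"
proof (rule dynamical_systemI)
  have closed: "closedin (full_shift G A) S"
    using assms by (simp add: subshift_def)
  show "compact_space (subshift_space G A S)"
    unfolding subshift_space_def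
    using assms closed
    by (intro compact_space_subtopology closedin_compact_space full_shift_compact) (simp_all add: subshift_def)
  show "Hausdorff_space (subshift_space G A S)"
    unfolding subshift_space_def by (intro Hausdorff_space_subtopology full_shift_Hausdorff)
  show "continuous_map (subshift_space G A S) (subshift_space G A S) (shift G g)" if "g \<in> carrier G" for g
    using assms that shift_continuous[OF that, of A] unfolding subshift_space_def
    by (intro continuous_map_into_subtopology continuous_map_from_subtopology)
       (auto simp: subshift_def)
  \<comment> \<open>\<open>shift\<close> restricts its result to the carrier, so the identity fixes
    \<open>s\<close> only because \<open>s\<close> is \<open>undefined\<close> outside it.\<close>
  have ext: "s \<in> extensional (carrier G)" if "s \<in> S" for s
    using closedin_subset[OF closed] that by (auto simp: PiE_iff)
  show "shift G \<one> s = s" if "s \<in> topspace (subshift_space G A S)" for s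
    using ext[of s] that topspace_subshift_space[OF assms]
    by (intro extensionalityI[of _ "carrier G"]) (simp_all add: shift_def)
  show "shift G (g \<otimes> h) s = shift G g (shift G h s)" if "g \<in> carrier G" "h \<in> carrier G" for g h s
    using that by (auto simp: shift_def fun_eq_iff m_assoc)
qed

section \<open>The symbolic extension of a system\<close>

text \<open>\<open>N\<close>, \<open>enc\<close> and \<open>dec\<close> carry the construction into
  the given types: an index \<open>l\<close> stands for the level \<open>N l\<close>, and a letter
  encodes a finite set of natural numbers. Closures appear in \<open>separating\<close> because
  limits of itineraries retain only membership in the closure of \<open>B i\<close>.\<close>

locale symbolic_extension = group G for G :: "('g, 'b) monoid_scheme" (structure) +
  fixes X :: "'x topology" and \<Phi> :: "'g \<Rightarrow> 'x \<Rightarrow> 'x"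
    and B :: "nat \<Rightarrow> 'x set" and N :: "'l \<Rightarrow> nat"
    and enc :: "nat set \<Rightarrow> 'a" and dec :: "'a \<Rightarrow> nat set"
  assumes countable_G: "countable (carrier G)"
    and system: "dynamical_system X G \<Phi>"
    and open_B: "openin X (B i)"
    and separating: "x \<in> topspace X \<Longrightarrow> y \<in> topspace X \<Longrightarrow> x \<noteq> y \<Longrightarrow> \<exists>i. x \<in> B i \<and> y \<notin> X closure_of B i"
    and surj_N: "surj N"
    and dec_enc: "finite I \<Longrightarrow> dec (enc I) = I"
begin

lemma compact_X: "compact_space X" and Hausdorff_X: "Hausdorff_space X"
  using system by (simp_all add: dynamical_system_def)

lemma action_mult: "g \<in> carrier G \<Longrightarrow> h \<in> carrier G \<Longrightarrow> x \<in> topspace X \<Longrightarrow> \<Phi> (g \<otimes> h) x = \<Phi> g (\<Phi> h x)"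
  using system by (simp add: dynamical_system_def)

lemma action_one: "x \<in> topspace X \<Longrightarrow> \<Phi> \<one> x = x"
  using system by (simp add: dynamical_system_def)

lemmas action_closed = dynamical_system_closed(2)[OF system]
lemmas action_continuous = dynamical_system_closed(1)[OF system]

section \<open>Generic points and their itineraries\<close>

definition generic :: "'x set" where
  "generic = {x \<in> topspace X. \<forall>g\<in>carrier G. \<forall>i. \<Phi> g x \<notin> X frontier_of B i}"

text \<open>This is the itinerary of \<open>x\<close> with respect to the first \<open>N l\<close>
  sets: the letter at \<open>g\<close> names the cell of the partition generated by these sets that
  contains \<open>\<Phi> g x\<close>.\<close>

definition code :: "'l \<Rightarrow> 'x \<Rightarrow> 'g \<Rightarrow> 'a" where
  "code l x = (\<lambda>g\<in>carrier G. enc {i. i < N l \<and> \<Phi> g x \<in> B i})"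

definition A :: "'l \<Rightarrow> 'a set" where
  "A l = enc ` Pow {..<N l}"

definition S :: "'l \<Rightarrow> ('g \<Rightarrow> 'a) set" where
  "S l = full_shift G (A l) closure_of (code l ` generic)"

text \<open>Only a preorder on \<open>'l\<close>, since \<open>N\<close> need not be injective.\<close>

definition leq :: "'l \<Rightarrow> 'l \<Rightarrow> bool" where
  "leq l m \<longleftrightarrow> N l \<le> N m"

text \<open>A one-block code in the sense of symbolic dynamics, hence continuous and
  shift-equivariant; it forgets the sets with index at least \<open>N l\<close>.\<close>

definition bond :: "'l \<Rightarrow> 'l \<Rightarrow> ('g \<Rightarrow> 'a) \<Rightarrow> ('g \<Rightarrow> 'a)" where
  "bond l m s = (\<lambda>g\<in>carrier G. enc (dec (s g) \<inter> {..<N l}))"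

lemma generic_subset: "generic \<subseteq> topspace X"
  by (auto simp: generic_def)

lemma generic_action:
  assumes "g \<in> carrier G" "x \<in> generic"
  shows "\<Phi> g x \<in> generic"
proof -
  have "\<Phi> h (\<Phi> g x) \<notin> X frontier_of B i" if "h \<in> carrier G" for h i
    using assms(2) m_closed[OF that assms(1)] action_mult[OF that assms(1), of x]
    by (auto simp: generic_def dest: bspec[of _ _ "h \<otimes> g"])
  then show ?thesis
    using assms action_closed by (auto simp: generic_def)
qed

text \<open>Baire category in the compact Hausdorff space \<open>X\<close>. The frontier of an open
  set is nowhere dense, homeomorphisms preserve this, and countability of the group leaves only
  countably many pairs of \<open>g\<close> and \<open>i\<close>.\<close>

lemma generic_dense: "X closure_of generic = topspace X"
proof -
  define T where "T g i = {x \<in> topspace X. \<Phi> g x \<in> topspace X - X frontier_of B i}" for g i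
  have T_open: "openin X (T g i)" if "g \<in> carrier G" for g i
    unfolding T_def
    by (rule openin_continuous_map_preimage[OF action_continuous[OF that]])
       (rule openin_diff[OF openin_topspace closedin_frontier_of])
  have T_dense: "X closure_of (T g i) = topspace X" if g: "g \<in> carrier G" for g i
    unfolding dense_intersects_open
  proof (intro allI impI, elim conjE)
    fix W assume W: "openin X W" "W \<noteq> {}"
    have "homeomorphic_map X X (\<Phi> g)"
      using system g by (simp add: dynamical_system_def)
    then have gW: "openin X (\<Phi> g ` W)"
      using W(1) homeomorphic_imp_open_map unfolding open_map_def by blast
    have sub: "W \<subseteq> topspace X"
      using W(1) by (rule openin_subset)
    \<comment> \<open>An open \<open>B i\<close> is disjoint from its frontier, and an open set that
      misses \<open>B i\<close> also misses its closure. Either way a point off the frontier is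
      found.\<close>
    obtain w where w: "w \<in> W" "\<Phi> g w \<notin> X frontier_of B i"
    proof (cases "\<exists>w\<in>W. \<Phi> g w \<in> B i")
      case True
      moreover have "B i \<inter> X frontier_of B i = {}"
        using open_B[of i] by (auto simp: frontier_of_def interior_of_openin)
      ultimately show ?thesis
        using that by blast
    next
      case False
      then have "\<Phi> g ` W \<inter> B i = {}"
        by blast
      then have "\<Phi> g ` W \<inter> X closure_of B i = {}"
        using openin_Int_closure_of_eq_empty[OF gW] by simp
      then show ?thesis
        using that W(2) by (auto simp: frontier_of_def)
    qed
    then have "w \<in> T g i"
      using sub action_closed[OF g] by (auto simp: T_def)
    then show "T g i \<inter> W \<noteq> {}"
      using w(1) by blast
  qed
  have "X closure_of \<Inter>((\<lambda>(g, i). T g i) ` (carrier G \<times> UNIV)) = topspace X"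
  proof (rule Baire_category)
    show "completely_metrizable_space X \<or> locally_compact_space X \<and> regular_space X"
      using compact_X Hausdorff_X compact_imp_locally_compact_space compact_Hausdorff_imp_regular_space by blast
    show "countable ((\<lambda>(g, i). T g i) ` (carrier G \<times> (UNIV :: nat set)))"
      using countable_G by (intro countable_image countable_SIGMA) auto
  qed (use T_open T_dense in auto)
  moreover have "\<Inter>((\<lambda>(g, i). T g i) ` (carrier G \<times> UNIV)) = generic"
  proof (intro equalityI subsetI)
    fix x assume "x \<in> \<Inter>((\<lambda>(g, i). T g i) ` (carrier G \<times> UNIV))"
    then have x: "x \<in> T g i" if "g \<in> carrier G" for g i
      using that by auto
    \<comment> \<open>The instance at the identity supplies
      \<open>x \<in> topspace X\<close>.\<close>
    then show "x \<in> generic"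
      using x[OF one_closed] by (simp add: T_def generic_def)
  next
    fix x assume "x \<in> generic"
    then show "x \<in> \<Inter>((\<lambda>(g, i). T g i) ` (carrier G \<times> UNIV))"
      using action_closed by (auto simp: T_def generic_def)
  qed
  ultimately show ?thesis
    by simp
qed

lemma code_shift:
  assumes "g \<in> carrier G" "x \<in> topspace X"
  shows "code l (\<Phi> g x) = shift G g (code l x)"
  using assms by (auto simp: code_def shift_def fun_eq_iff action_mult)

lemma dec_code: "g \<in> carrier G \<Longrightarrow> dec (code l x g) = {i. i < N l \<and> \<Phi> g x \<in> B i}"
  by (simp add: code_def dec_enc)

lemma code_in_A: "g \<in> carrier G \<Longrightarrow> code l x g \<in> A l"
  by (auto simp: code_def A_def)

lemma code_in_full_shift: "code l x \<in> topspace (full_shift G (A l))"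
  using code_in_A by (auto simp: code_def)

text \<open>If \<open>\<Phi> g x\<close> avoids all frontiers, then for each \<open>i\<close> it
  lies either in \<open>B i\<close> or outside the closure of \<open>B i\<close>, and both
  conditions are open. A letter depends on finitely many \<open>i\<close> only, so each coordinate
  of the code is locally constant on generic points.\<close>

lemma code_continuous: "continuous_map (subtopology X generic) (full_shift G (A l)) (code l)"
proof (rule continuous_map_full_shiftI)
  fix g assume g: "g \<in> carrier G"
  let ?Y = "subtopology X generic"
  have const: "\<exists>W. openin X W \<and> x \<in> W \<and> (\<forall>y\<in>W \<inter> generic. code l y g = code l x g)" if x: "x \<in> generic" for x
  proof -
    define Q where "Q i = (if \<Phi> g x \<in> B i then B i else topspace X - X closure_of B i)" for i
    define W where "W = \<Inter>(insert (topspace X) ((\<lambda>i. {y \<in> topspace X. \<Phi> g y \<in> Q i}) ` {..<N l}))"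
    have "openin X (Q i)" for i
      using open_B by (simp add: Q_def openin_diff)
    then have Q_open: "openin X {y \<in> topspace X. \<Phi> g y \<in> Q i}" for i
      by (rule openin_continuous_map_preimage[OF action_continuous[OF g]])
    have "openin X W"
      unfolding W_def by (rule openin_Inter) (use Q_open in auto)
    moreover have "\<Phi> g x \<in> Q i" for i
    proof -
      have "\<Phi> g x \<notin> X closure_of B i" if "\<Phi> g x \<notin> B i"
        using x g that interior_of_openin[OF open_B[of i]] by (auto simp: generic_def frontier_of_def)
      then show ?thesis
        using x g action_closed generic_subset by (auto simp: Q_def)
    qed
    then have "x \<in> W"
      using x generic_subset by (auto simp: W_def)
    moreover have "code l y g = code l x g" if "y \<in> W" for y
    proof -
      have "\<Phi> g y \<in> B i \<longleftrightarrow> \<Phi> g x \<in> B i" if "i < N l" for i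
      proof -
        have "\<Phi> g y \<in> Q i"
          using \<open>y \<in> W\<close> that by (simp add: W_def)
        then show ?thesis
          using closure_of_subset[OF openin_subset[OF open_B[of i]]] by (auto simp: Q_def split: if_splits)
      qed
      then show ?thesis
        using g by (auto simp: code_def intro!: arg_cong[of _ _ enc])
    qed
    ultimately show ?thesis
      by blast
  qed
  show "continuous_map ?Y (discrete_topology (A l)) (\<lambda>x. code l x g)"
    unfolding continuous_map_def
  proof (intro conjI allI impI)
    fix U
    show "openin ?Y {x \<in> topspace ?Y. code l x g \<in> U}"
    proof (subst openin_subopen, intro ballI)
      fix x assume x: "x \<in> {x \<in> topspace ?Y. code l x g \<in> U}"
      then have "x \<in> generic"
        by simp
      then obtain W where W: "openin X W" "x \<in> W" "\<forall>y\<in>W \<inter> generic. code l y g = code l x g"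
        using const by blast
      show "\<exists>T. openin ?Y T \<and> x \<in> T \<and> T \<subseteq> {x \<in> topspace ?Y. code l x g \<in> U}"
      proof (intro exI[of _ "W \<inter> generic"] conjI subsetI)
        show "openin ?Y (W \<inter> generic)"
          using W(1) openin_subtopology by blast
        show "x \<in> W \<inter> generic"
          using W(2) \<open>x \<in> generic\<close> by blast
        fix y assume y: "y \<in> W \<inter> generic"
        then show "y \<in> {x \<in> topspace ?Y. code l x g \<in> U}"
          using x W(3)[rule_format, OF y] generic_subset by auto
      qed
    qed
  qed (use code_in_A[OF g] in auto)
qed (simp add: code_def)

lemma finite_A: "finite (A l)"
  by (simp add: A_def)

lemma code_in_S: "x \<in> generic \<Longrightarrow> code l x \<in> S l"
proof -
  have "code l ` generic \<subseteq> topspace (full_shift G (A l))"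
    using code_in_full_shift by blast
  then show "x \<in> generic \<Longrightarrow> code l x \<in> S l"
    unfolding S_def using closure_of_subset by blast
qed

lemma subshift_S: "subshift G (A l) (S l)"
proof -
  have "shift G g ` S l \<subseteq> S l" if g: "g \<in> carrier G" for g
  proof -
    have "shift G g ` code l ` generic \<subseteq> code l ` generic"
      using generic_action[OF g] generic_subset code_shift[OF g, of _ l] by (auto simp: image_iff) (metis subsetD)
    then have "full_shift G (A l) closure_of (shift G g ` code l ` generic) \<subseteq> S l"
      unfolding S_def by (rule closure_of_mono)
    then show ?thesis
      using continuous_map_image_closure_subset[OF shift_continuous[OF g], of "A l" "code l ` generic"]
      unfolding S_def by blast
  qed
  then show ?thesis
    by (simp add: subshift_def finite_A S_def)
qed

section \<open>The inverse system of the subshifts\<close>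

abbreviation Y :: "'l \<Rightarrow> ('g \<Rightarrow> 'a) topology" where
  "Y l \<equiv> subshift_space G (A l) (S l)"

lemmas topspace_Y = topspace_subshift_space[OF subshift_S]
lemmas Y_system = subshift_dynamical_system[OF subshift_S]

lemma code_dense: "Y l closure_of (code l ` generic) = S l"
proof -
  have "code l ` generic \<subseteq> S l"
    using code_in_S by blast
  then show ?thesis
    unfolding subshift_space_def closure_of_subtopology by (simp add: Int_absorb1 flip: S_def)
qed

lemma has_property_Y:
  assumes "has_property P X G \<Phi>"
  shows "has_property P (Y l) G (shift G)"
proof (rule has_property_dense_image[OF system Y_system generic_subset generic_dense])
  show "continuous_map (subtopology X generic) (Y l) (code l)"
    unfolding subshift_space_def using code_in_S
    by (intro continuous_map_into_subtopology code_continuous) auto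
  show "Y l closure_of (code l ` generic) = topspace (Y l)"
    by (simp add: code_dense topspace_Y)
qed (use assms generic_action generic_subset code_shift in blast)+

lemma bond_code:
  assumes "leq l m"
  shows "bond l m (code m x) = code l x"
  using assms by (auto simp: bond_def fun_eq_iff dec_code leq_def code_def dec_enc intro!: arg_cong[of _ _ enc])

lemma bond_continuous_full: "continuous_map (full_shift G (A m)) (full_shift G (A l)) (bond l m)"
proof (rule continuous_map_full_shiftI)
  fix g assume g: "g \<in> carrier G"
  have "continuous_map (discrete_topology (A m)) (discrete_topology (A l)) (\<lambda>a. enc (dec a \<inter> {..<N l}))"
    by (auto simp: A_def)
  from continuous_map_compose[OF full_shift_coordinate[OF g] this]
  show "continuous_map (full_shift G (A m)) (discrete_topology (A l)) (\<lambda>s. bond l m s g)"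
    using g by (simp add: bond_def o_def)
qed (simp add: bond_def)

text \<open>On codes the bonding map only drops indices, so it carries the codes at \<open>m\<close>
  onto those at \<open>l\<close>. Being continuous and closed, it also carries the closure onto the
  closure. This surjectivity makes the Mittag-Leffler condition immediate.\<close>

lemma bond_image:
  assumes "leq l m"
  shows "bond l m ` S m = S l"
proof -
  have eq: "bond l m ` code m ` generic = code l ` generic"
    using bond_code[OF assms] by (simp add: image_image)
  have "code m ` generic \<subseteq> topspace (full_shift G (A m))"
    using code_in_full_shift by blast
  moreover have "closed_map (full_shift G (A m)) (full_shift G (A l)) (bond l m)"
    by (rule continuous_imp_closed_map[OF bond_continuous_full full_shift_compact[OF finite_A] full_shift_Hausdorff])
  ultimately have "S l \<subseteq> bond l m ` S m"
    unfolding closed_map_closure_of_image S_def eq[symmetric] by blast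
  moreover have "bond l m ` S m \<subseteq> S l"
    using continuous_map_image_closure_subset[OF bond_continuous_full, of l m "code m ` generic"]
    unfolding S_def eq .
  ultimately show ?thesis
    by blast
qed

lemma bond_continuous: "leq l m \<Longrightarrow> continuous_map (Y m) (Y l) (bond l m)"
  using bond_image[of l m] unfolding subshift_space_def
  by (intro continuous_map_into_subtopology continuous_map_from_subtopology bond_continuous_full) auto

lemma in_S_coordinate: "s \<in> S l \<Longrightarrow> g \<in> carrier G \<Longrightarrow> s g \<in> A l"
  using subshift_S[of l] closedin_subset[of "full_shift G (A l)" "S l"] by (auto simp: subshift_def)

lemma in_S_extensional: "s \<in> S l \<Longrightarrow> s \<in> extensional (carrier G)"
  using subshift_S[of l] closedin_subset[of "full_shift G (A l)" "S l"] by (auto simp: subshift_def PiE_iff)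

lemma enc_dec: "a \<in> A l \<Longrightarrow> finite (dec a) \<and> dec a \<subseteq> {..<N l} \<and> enc (dec a) = a"
  unfolding A_def using dec_enc finite_subset[OF _ finite_lessThan] by auto

lemma inverse_system_Y: "inverse_system G UNIV leq Y (\<lambda>_. shift G) bond"
  unfolding inverse_system_def topspace_Y
proof (intro conjI ballI impI)
  show "directed_set UNIV leq"
    unfolding directed_set_def leq_def by (auto intro: nat_le_linear) (meson nat_le_linear order_refl)
  show "bond l l s = s" if "s \<in> S l" for l s
  proof (rule extensionalityI[of _ "carrier G"])
    show "bond l l s g = s g" if "g \<in> carrier G" for g
      using enc_dec[OF in_S_coordinate[OF \<open>s \<in> S l\<close> that]] that by (simp add: bond_def Int_absorb2)
  qed (use in_S_extensional[OF that] in \<open>simp_all add: bond_def\<close>)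
  show "bond l n s = bond l m (bond m n s)" if "leq l m" "s \<in> S n" for l m n s
  proof -
    have "dec (s g) \<inter> {..<N l} = dec (enc (dec (s g) \<inter> {..<N m})) \<inter> {..<N l}" if "g \<in> carrier G" for g
      using \<open>leq l m\<close> by (auto simp: dec_enc leq_def)
    then show ?thesis
      by (simp add: bond_def cong: restrict_cong)
  qed
  show "shift G g (bond l m s) = bond l m (shift G g s)" if "g \<in> carrier G" for l m g s
    using that by (auto simp: shift_def bond_def)
qed (use Y_system bond_continuous in auto)

lemma Mittag_Leffler_Y: "Mittag_Leffler UNIV leq Y bond"
  unfolding Mittag_Leffler_def topspace_Y
proof (intro ballI)
  fix l
  have "leq l l"
    by (simp add: leq_def)
  then show "\<exists>m\<in>UNIV. leq l m \<and> (\<forall>n\<in>UNIV. leq m n \<longrightarrow> bond l n ` S n = bond l m ` S m)"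
    using bond_image by (intro bexI[of _ l]) auto
qed

sublocale limit: inverse_system_of_systems G UNIV leq Y "\<lambda>_. shift G" bond
  by unfold_locales (rule inverse_system_Y)

section \<open>The factor map\<close>

text \<open>The graph of the factor map, as a closed relation: its continuity, totality and surjectivity
  then follow from compactness.\<close>

definition coded_pairs :: "(('l \<Rightarrow> 'g \<Rightarrow> 'a) \<times> 'x) set" where
  "coded_pairs = {p \<in> topspace (prod_topology limit.Z X).
     \<forall>g\<in>carrier G. \<forall>l\<in>UNIV. \<forall>i\<in>{..<N l}.
       \<Phi> g (snd p) \<in> (if i \<in> dec (fst p l g) then X closure_of B i else topspace X - B i)}"

lemma coded_pairsI:
  assumes "z \<in> topspace limit.Z" "x \<in> topspace X"
    and "\<And>g l i. g \<in> carrier G \<Longrightarrow> i < N l \<Longrightarrow> i \<in> dec (z l g) \<Longrightarrow> \<Phi> g x \<in> X closure_of B i"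
    and "\<And>g l i. g \<in> carrier G \<Longrightarrow> i < N l \<Longrightarrow> i \<notin> dec (z l g) \<Longrightarrow> \<Phi> g x \<notin> B i"
  shows "(z, x) \<in> coded_pairs"
  using assms action_closed by (simp add: coded_pairs_def)

lemma coded_pairsD:
  assumes "(z, x) \<in> coded_pairs"
  shows "z \<in> topspace limit.Z" "x \<in> topspace X"
    and "g \<in> carrier G \<Longrightarrow> i < N l \<Longrightarrow> i \<in> dec (z l g) \<Longrightarrow> \<Phi> g x \<in> X closure_of B i"
    and "g \<in> carrier G \<Longrightarrow> i < N l \<Longrightarrow> i \<notin> dec (z l g) \<Longrightarrow> \<Phi> g x \<notin> B i"
proof -
  show "z \<in> topspace limit.Z" "x \<in> topspace X"
    using assms by (simp_all add: coded_pairs_def)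
  have *: "\<Phi> g x \<in> (if i \<in> dec (z l g) then X closure_of B i else topspace X - B i)"
    if "g \<in> carrier G" "i < N l"
    using assms that unfolding coded_pairs_def by fastforce
  show "g \<in> carrier G \<Longrightarrow> i < N l \<Longrightarrow> i \<in> dec (z l g) \<Longrightarrow> \<Phi> g x \<in> X closure_of B i"
    "g \<in> carrier G \<Longrightarrow> i < N l \<Longrightarrow> i \<notin> dec (z l g) \<Longrightarrow> \<Phi> g x \<notin> B i"
    using * by auto
qed

lemma limit_in_S: "z \<in> topspace limit.Z \<Longrightarrow> z l \<in> S l"
  using limit.limit_coordinate[of z l] by (simp add: topspace_Y)

text \<open>Letters form a discrete space, so each condition on a letter is clopen, and it is paired
  with a closed condition on the point. This is why \<open>coded_pairs\<close> asks for the closure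
  of \<open>B i\<close> in one case and the complement of the open \<open>B i\<close> in the
  other.\<close>

lemma closedin_coded_pairs: "closedin (prod_topology limit.Z X) coded_pairs"
proof -
  let ?W = "prod_topology limit.Z X"
  have "closedin ?W {p \<in> topspace ?W. \<Phi> g (snd p) \<in> (if i \<in> dec (fst p l g) then X closure_of B i else topspace X - B i)}"
    (is "closedin ?W ?K") if g: "g \<in> carrier G" for g l i
  proof -
    have "continuous_map (Y l) (discrete_topology (A l)) (\<lambda>s. s g)"
      unfolding subshift_space_def by (rule continuous_map_from_subtopology[OF full_shift_coordinate[OF g]])
    from continuous_map_compose[OF continuous_map_compose[OF continuous_map_fst limit.projection_continuous[of l]] this]
    have 1: "continuous_map ?W (discrete_topology (A l)) (\<lambda>p. fst p l g)"
      by (simp add: o_def)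
    have 2: "continuous_map ?W X (\<lambda>p. \<Phi> g (snd p))"
      using continuous_map_compose[OF continuous_map_snd action_continuous[OF g], of limit.Z] by (simp add: o_def)
    have 3: "closedin ?W {p \<in> topspace ?W. fst p l g \<in> {a \<in> A l. Q a}}" for Q
      by (rule closedin_continuous_map_preimage[OF 1]) auto
    have 4: "closedin ?W {p \<in> topspace ?W. \<Phi> g (snd p) \<in> C}" if "closedin X C" for C
      by (rule closedin_continuous_map_preimage[OF 2 that])
    have A: "fst p l g \<in> A l" if "p \<in> topspace ?W" for p
      using in_S_coordinate[OF limit_in_S g] that by auto
    have "?K = {p \<in> topspace ?W. fst p l g \<in> {a \<in> A l. i \<in> dec a}} \<inter> {p \<in> topspace ?W. \<Phi> g (snd p) \<in> X closure_of B i} \<union>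
          {p \<in> topspace ?W. fst p l g \<in> {a \<in> A l. i \<notin> dec a}} \<inter> {p \<in> topspace ?W. \<Phi> g (snd p) \<in> topspace X - B i}"
      using A by (auto simp del: topspace_prod_topology split: if_splits)
    moreover have "closedin X (topspace X - B i)"
      using open_B by blast
    ultimately show ?thesis
      by (simp only:) (intro closedin_Un closedin_Int 3 4 closedin_closure_of)
  qed
  then show ?thesis
    unfolding coded_pairs_def by (intro closedin_Collect_ball)
qed

lemma limit_code_in_limit:
  assumes "x \<in> generic"
  shows "(\<lambda>l. code l x) \<in> topspace limit.Z"
  unfolding limit.in_limit_iff topspace_Y using code_in_S[OF assms] bond_code by auto

lemma limit_code_coded:
  assumes "x \<in> generic"
  shows "(\<lambda>l. code l x, x) \<in> coded_pairs"
proof (rule coded_pairsI[OF limit_code_in_limit[OF assms]])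
  show "x \<in> topspace X"
    using assms generic_subset by blast
  fix g l i assume "g \<in> carrier G" "i < N l"
  then show "i \<in> dec (code l x g) \<Longrightarrow> \<Phi> g x \<in> X closure_of B i"
    and "i \<notin> dec (code l x g) \<Longrightarrow> \<Phi> g x \<notin> B i"
    using closure_of_subset[OF openin_subset[OF open_B[of i]]] by (auto simp: dec_code)
qed

text \<open>A nonempty open set of the limit contains one depending on a single coordinate
  \<open>l\<close>, where the codes are dense in \<open>S l\<close>. The whole family of codes of a
  suitable generic point then lies in it.\<close>

lemma limit_code_dense: "limit.Z closure_of ((\<lambda>x l. code l x) ` generic) = topspace limit.Z"
  unfolding dense_intersects_open
proof (intro allI impI, elim conjE)
  fix U assume U: "openin limit.Z U" "U \<noteq> {}"
  then obtain z where z: "z \<in> U"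
    by blast
  obtain l W where W: "openin (Y l) W" "z l \<in> W" "\<forall>y\<in>topspace limit.Z. y l \<in> W \<longrightarrow> y \<in> U"
    using limit.limit_base[OF U(1) z] by blast
  have "Y l closure_of (code l ` generic) = topspace (Y l)"
    by (simp add: code_dense topspace_Y)
  from this[unfolded dense_intersects_open, rule_format, of W]
  have "code l ` generic \<inter> W \<noteq> {}"
    using W(1,2) by blast
  then obtain x where x: "x \<in> generic" "code l x \<in> W"
    by blast
  have "(\<lambda>l. code l x) \<in> U"
    by (rule W(3)[rule_format, OF limit_code_in_limit[OF x(1)] x(2)])
  then show "(\<lambda>x l. code l x) ` generic \<inter> U \<noteq> {}"
    using x(1) by (auto simp: disjoint_iff)
qed

lemma closed_map_fst_limit: "closed_map (prod_topology limit.Z X) limit.Z fst"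
  by (intro continuous_imp_closed_map continuous_map_fst limit.limit_Hausdorff)
     (simp add: compact_space_prod_topology limit.limit_compact compact_X)

lemma closed_map_snd_limit: "closed_map (prod_topology limit.Z X) X snd"
  by (intro continuous_imp_closed_map continuous_map_snd Hausdorff_X)
     (simp add: compact_space_prod_topology limit.limit_compact compact_X)

text \<open>Totality of the relation: its projection is closed by compactness and contains the dense
  set of families of codes.\<close>

lemma fst_coded_pairs: "fst ` coded_pairs = topspace limit.Z"
proof (rule subset_antisym)
  have "closedin limit.Z (fst ` coded_pairs)"
    using closed_map_fst_limit closedin_coded_pairs by (simp add: closed_map_def)
  moreover have "(\<lambda>x l. code l x) ` generic \<subseteq> fst ` coded_pairs"
    using limit_code_coded by force
  ultimately show "topspace limit.Z \<subseteq> fst ` coded_pairs"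
    unfolding limit_code_dense[symmetric] by (rule closure_of_minimal[rotated])
qed (use coded_pairsD(1) in auto)

text \<open>Surjectivity of the factor map, by the same argument with the dense set of generic
  points.\<close>

lemma snd_coded_pairs: "snd ` coded_pairs = topspace X"
proof (rule subset_antisym)
  have "closedin X (snd ` coded_pairs)"
    using closed_map_snd_limit closedin_coded_pairs by (simp add: closed_map_def)
  moreover have "generic \<subseteq> snd ` coded_pairs"
    using limit_code_coded by force
  ultimately show "topspace X \<subseteq> snd ` coded_pairs"
    unfolding generic_dense[symmetric] by (rule closure_of_minimal[rotated])
qed (use coded_pairsD(2) in auto)

text \<open>Take \<open>B i\<close> separating \<open>x\<close> from \<open>y\<close> and look at
  the letter at the identity. If it contains \<open>i\<close>, then \<open>y\<close> lies in the
  closure of \<open>B i\<close>; otherwise \<open>x\<close> lies outside \<open>B i\<close>. Both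
  contradict the choice of \<open>i\<close>.\<close>

lemma coded_pairs_unique:
  assumes "(z, x) \<in> coded_pairs" "(z, y) \<in> coded_pairs"
  shows "x = y"
proof (rule ccontr)
  assume "x \<noteq> y"
  then obtain i where i: "x \<in> B i" "y \<notin> X closure_of B i"
    using separating[OF coded_pairsD(2)[OF assms(1)] coded_pairsD(2)[OF assms(2)]] by blast
  \<comment> \<open>The level must exceed \<open>i\<close> for the letters to record
    \<open>B i\<close>; surjectivity of \<open>N\<close> provides one.\<close>
  obtain l where "N l = Suc i"
    using surj_N by (metis surjD)
  then show False
    using i coded_pairsD(3)[OF assms(2) one_closed, of i l] coded_pairsD(4)[OF assms(1) one_closed, of i l]
      action_one[OF coded_pairsD(2)[OF assms(1)]] action_one[OF coded_pairsD(2)[OF assms(2)]]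
    by (cases "i \<in> dec (z l \<one>)") simp_all
qed

lemma coded_pairs_action:
  assumes "(z, x) \<in> coded_pairs" "g \<in> carrier G"
  shows "(coordinatewise_action UNIV (\<lambda>_. shift G) g z, \<Phi> g x) \<in> coded_pairs"
proof (rule coded_pairsI)
  show "coordinatewise_action UNIV (\<lambda>_. shift G) g z \<in> topspace limit.Z"
    using limit.action_closed assms coded_pairsD(1) by blast
  show "\<Phi> g x \<in> topspace X"
    using action_closed assms coded_pairsD(2) by blast
  fix h l i assume h: "h \<in> carrier G" and "i < N l"
  have "coordinatewise_action UNIV (\<lambda>_. shift G) g z l h = z l (h \<otimes> g)"
    using h by (simp add: coordinatewise_action_def shift_def)
  moreover have "\<Phi> h (\<Phi> g x) = \<Phi> (h \<otimes> g) x"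
    using action_mult[OF h assms(2)] coded_pairsD(2)[OF assms(1)] by simp
  ultimately show "i \<in> dec (coordinatewise_action UNIV (\<lambda>_. shift G) g z l h) \<Longrightarrow> \<Phi> h (\<Phi> g x) \<in> X closure_of B i"
    and "i \<notin> dec (coordinatewise_action UNIV (\<lambda>_. shift G) g z l h) \<Longrightarrow> \<Phi> h (\<Phi> g x) \<notin> B i"
    using coded_pairsD(3,4)[OF assms(1) m_closed[OF h assms(2)] \<open>i < N l\<close>] by simp_all
qed

lemma factor_of_limit: "is_factor G X \<Phi> limit.Z (coordinatewise_action UNIV (\<lambda>_. shift G))"
proof -
  define F where "F z = (THE x. (z, x) \<in> coded_pairs)" for z
  have F_eq: "F z = x" if "(z, x) \<in> coded_pairs" for z x
    unfolding F_def using that coded_pairs_unique by blast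
  have F: "(z, F z) \<in> coded_pairs" if z: "z \<in> topspace limit.Z" for z
  proof -
    obtain x where "(z, x) \<in> coded_pairs"
      using z unfolding fst_coded_pairs[symmetric] by auto
    then show ?thesis
      using F_eq by simp
  qed
  have "continuous_map limit.Z X F"
    unfolding continuous_map_closedin
  proof (intro conjI allI impI)
    show "F \<in> topspace limit.Z \<rightarrow> topspace X"
      using F coded_pairsD(2) by blast
    fix C assume C: "closedin X C"
    \<comment> \<open>Closed graph argument: the preimage of \<open>C\<close> under \<open>F\<close>
      is the projection of the part of the graph lying over \<open>C\<close>.\<close>
    have "closedin (prod_topology limit.Z X) (coded_pairs \<inter> topspace limit.Z \<times> C)"
      by (intro closedin_Int closedin_coded_pairs) (simp add: closedin_prod_Times_iff C)
    then have "closedin limit.Z (fst ` (coded_pairs \<inter> topspace limit.Z \<times> C))"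
      using closed_map_fst_limit by (simp add: closed_map_def)
    moreover have "{z \<in> topspace limit.Z. F z \<in> C} = fst ` (coded_pairs \<inter> topspace limit.Z \<times> C)"
    proof (intro equalityI subsetI)
      fix z assume "z \<in> {z \<in> topspace limit.Z. F z \<in> C}"
      then have "(z, F z) \<in> coded_pairs \<inter> topspace limit.Z \<times> C"
        using F[of z] by simp
      then show "z \<in> fst ` (coded_pairs \<inter> topspace limit.Z \<times> C)"
        by (rule image_eqI[rotated]) simp
    next
      fix z assume "z \<in> fst ` (coded_pairs \<inter> topspace limit.Z \<times> C)"
      then obtain x where "(z, x) \<in> coded_pairs" "z \<in> topspace limit.Z" "x \<in> C"
        by auto
      then show "z \<in> {z \<in> topspace limit.Z. F z \<in> C}"
        using F_eq[of z x] by simp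
    qed
    ultimately show "closedin limit.Z {z \<in> topspace limit.Z. F z \<in> C}"
      by simp
  qed
  moreover have "F ` topspace limit.Z = topspace X"
  proof (intro equalityI subsetI)
    fix x assume "x \<in> topspace X"
    then obtain z where "(z, x) \<in> coded_pairs"
      unfolding snd_coded_pairs[symmetric] by auto
    then show "x \<in> F ` topspace limit.Z"
      using F_eq coded_pairsD(1) by blast
  qed (use F coded_pairsD(2) in blast)
  moreover have "\<Phi> g (F z) = F (coordinatewise_action UNIV (\<lambda>_. shift G) g z)"
    if "g \<in> carrier G" "z \<in> topspace limit.Z" for g z
    using F_eq[OF coded_pairs_action[OF F[OF that(2)] that(1)]] by simp
  ultimately show ?thesis
    unfolding is_factor_def by blast
qed

end

section \<open>Separating sequences and encodings\<close>

lemma (in Metric_space) compact_imp_separating_sequence: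
  assumes "compact_space mtopology"
  shows "\<exists>B :: nat \<Rightarrow> 'a set. (\<forall>i. openin mtopology (B i)) \<and>
     (\<forall>x\<in>M. \<forall>y\<in>M. x \<noteq> y \<longrightarrow> (\<exists>i. x \<in> B i \<and> y \<notin> mtopology closure_of B i))"
proof -
  have "mtotally_bounded M"
    using assms compactin_imp_mtotally_bounded by (simp add: compact_space_def)
  then have "\<exists>K. finite K \<and> K \<subseteq> M \<and> M \<subseteq> (\<Union>x\<in>K. mball x (inverse (real (Suc n))))" for n
    unfolding mtotally_bounded_def by (meson inverse_positive_iff_positive of_nat_0_less_iff zero_less_Suc)
  then obtain K where K: "\<And>n. finite (K n)" "\<And>n. K n \<subseteq> M" "\<And>n. M \<subseteq> (\<Union>x\<in>K n. mball x (inverse (real (Suc n))))"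
    by metis
  \<comment> \<open>Balls around finite nets of every scale form a countable family. The empty set
    is added so that the family can be enumerated even when \<open>M\<close> is empty.\<close>
  define \<B> where "\<B> = insert {} (\<Union>n. (\<lambda>x. mball x (inverse (real (Suc n)))) ` K n)"
  have "countable \<B>"
    using K(1) by (auto simp: \<B>_def intro: countable_finite)
  moreover have "\<B> \<noteq> {}"
    by (simp add: \<B>_def)
  ultimately have range: "range (from_nat_into \<B>) = \<B>"
    by (rule range_from_nat_into[rotated])
  have "openin mtopology (from_nat_into \<B> i)" for i
  proof -
    have "from_nat_into \<B> i \<in> \<B>"
      using range by blast
    then show ?thesis
      by (auto simp: \<B>_def)
  qed
  moreover have "\<exists>i. x \<in> from_nat_into \<B> i \<and> y \<notin> mtopology closure_of from_nat_into \<B> i"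
    if xy: "x \<in> M" "y \<in> M" "x \<noteq> y" for x y
  proof -
    \<comment> \<open>A closed ball of radius below half the distance cannot contain both
      points.\<close>
    have "d x y / 2 > 0"
      using xy by simp
    then obtain n where n: "inverse (real (Suc n)) < d x y / 2"
      using reals_Archimedean by blast
    obtain c where c: "c \<in> K n" "x \<in> mball c (inverse (real (Suc n)))"
      using K(3)[of n] xy(1) by blast
    have "y \<notin> mcball c (inverse (real (Suc n)))"
    proof
      assume "y \<in> mcball c (inverse (real (Suc n)))"
      then have "d c x < d x y / 2" "d c y < d x y / 2" "c \<in> M"
        using c(2) n by auto
      then show False
        using triangle[of x c y] xy commute[of c x] by linarith
    qed
    moreover have "mtopology closure_of mball c (inverse (real (Suc n))) \<subseteq> mcball c (inverse (real (Suc n)))"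
      by (intro closure_of_minimal mball_subset_mcball closedin_mcball)
    moreover have "mball c (inverse (real (Suc n))) \<in> range (from_nat_into \<B>)"
      unfolding range using c(1) by (auto simp: \<B>_def)
    ultimately show ?thesis
      using c(2) by (metis rangeE subsetD)
  qed
  ultimately show ?thesis
    by blast
qed

lemma infinite_type_surj_nat: "\<exists>N :: 'l::infinite \<Rightarrow> nat. surj N"
proof -
  obtain \<iota> :: "nat \<Rightarrow> 'l" where "inj \<iota>"
    using infinite_countable_subset[OF infinite_UNIV] by blast
  then show ?thesis
    using inj_imp_surj_inv by blast
qed

text \<open>Binary expansion turns a finite set into a natural number, which an injection then turns
  into a letter.\<close>

lemma infinite_type_encodes_finite_sets:
  "\<exists>(enc :: nat set \<Rightarrow> 'a::infinite) dec. \<forall>I. finite I \<longrightarrow> dec (enc I) = I"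
proof -
  obtain \<kappa> :: "nat \<Rightarrow> 'a" where "inj \<kappa>"
    using infinite_countable_subset[OF infinite_UNIV] by blast
  then show ?thesis
    by (intro exI[of _ "\<lambda>I. \<kappa> (set_encode I)"] exI[of _ "\<lambda>a. set_decode (inv_into UNIV \<kappa> a)"])
       (simp add: set_encode_inverse)
qed

section \<open>The equivalence\<close>

theorem theorem1p5:
  fixes G :: "('g, 'b) monoid_scheme"
    and M :: "'x set" and d :: "'x \<Rightarrow> 'x \<Rightarrow> real"
    and \<Phi> :: "'g \<Rightarrow> 'x \<Rightarrow> 'x"
    and P :: dynamical_property
  assumes "group G" and "countable (carrier G)"
    and "Metric_space M d"
    and "dynamical_system (Metric_space.mtopology M d) G \<Phi>"
  shows "has_property P (Metric_space.mtopology M d) G \<Phi> \<longleftrightarrow>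
         is_factor_of_ML_limit_of_subshifts TYPE('l::infinite) TYPE('a::infinite) P
           (Metric_space.mtopology M d) G \<Phi>"
proof
  interpret group G by fact
  interpret Metric_space M d by fact
  assume P: "has_property P mtopology G \<Phi>"
  have "compact_space mtopology"
    using assms(4) by (simp add: dynamical_system_def)
  from compact_imp_separating_sequence[OF this]
  obtain B :: "nat \<Rightarrow> 'x set" where B: "\<forall>i. openin mtopology (B i)"
    "\<forall>x\<in>M. \<forall>y\<in>M. x \<noteq> y \<longrightarrow> (\<exists>i. x \<in> B i \<and> y \<notin> mtopology closure_of B i)"
    by (elim exE conjE) (rule that)
  obtain N :: "'l \<Rightarrow> nat" where N: "surj N"
    using infinite_type_surj_nat by blast
  obtain enc :: "nat set \<Rightarrow> 'a" and dec where dec: "\<forall>I. finite I \<longrightarrow> dec (enc I) = I"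
    using infinite_type_encodes_finite_sets by blast
  interpret E: symbolic_extension G mtopology \<Phi> B N enc dec
    using assms(2,4) B N dec by unfold_locales simp_all
  show "is_factor_of_ML_limit_of_subshifts TYPE('l) TYPE('a) P mtopology G \<Phi>"
    unfolding is_factor_of_ML_limit_of_subshifts_def Mittag_Leffler_system_def
    \<comment> \<open>All of \<open>'l\<close> serves as the index set, preordered through
      \<open>N\<close>; several indices may carry the same level.\<close>
    by (intro exI[of _ UNIV] exI[of _ E.leq] exI[of _ E.A] exI[of _ E.S] exI[of _ E.bond] conjI ballI
        E.subshift_S E.has_property_Y[OF P] E.inverse_system_Y E.Mittag_Leffler_Y E.factor_of_limit)
next
  interpret group G by fact
  assume "is_factor_of_ML_limit_of_subshifts TYPE('l) TYPE('a) P (Metric_space.mtopology M d) G \<Phi>"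
  then obtain L :: "'l set" and leq and A :: "'l \<Rightarrow> 'a set" and S \<phi> where
      P: "\<forall>l\<in>L. subshift G (A l) (S l) \<and> has_property P (subshift_space G (A l) (S l)) G (shift G)"
    and Y: "Mittag_Leffler_system G L leq (\<lambda>l. subshift_space G (A l) (S l)) (\<lambda>_. shift G) \<phi>"
    and F: "is_factor G (Metric_space.mtopology M d) \<Phi>
          (inverse_limit L leq (\<lambda>l. subshift_space G (A l) (S l)) \<phi>)
          (coordinatewise_action L (\<lambda>_. shift G))"
    unfolding is_factor_of_ML_limit_of_subshifts_def by blast
  interpret inverse_system_of_systems G L leq "\<lambda>l. subshift_space G (A l) (S l)" "\<lambda>_. shift G" \<phi>
    using Y by unfold_locales (simp add: Mittag_Leffler_system_def)
  \<comment> \<open>The property passes to the limit by Mittag-Leffler stability and from there to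
    its factor.\<close>
  have "has_property P Z G (coordinatewise_action L (\<lambda>_. shift G))"
    using Y P by (intro has_property_ML_limit) (simp_all add: Mittag_Leffler_system_def)
  then show "has_property P (Metric_space.mtopology M d) G \<Phi>"
    by (rule has_property_factor[OF limit_dynamical_system assms(4) F])
qed

end
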